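(* For every integer $N\ge 4$, the system $\alpha_1=\alpha_2=\dots=\alpha_N=0$ in the unknowns $(c_1,\dots,c_N)\in\mathbb C^N$ has a solution of multiplicity larger than $1$. In particular, for every $N\ge 4$ one has $|U_N|<N!$, and the ideal $\widehat I_N\subset\mathbb C[C_0,C_1,\dots,C_N]$ generated by the homogenizations $\widehat\alpha_1,\dots,\widehat\alpha_N$ is not radical.
   Context: Let $s_j^{(N)}(c_1,\dots,c_N)$ be the $j$-th elementary symmetric polynomial in $c_1,\dots,c_N$. Put $\alpha_j=s_j^{(N)}(c_1,\dots,c_N)-(-1)^jc_j\in\mathbb C[c_1,\dots,c_N]$ for $j=1,\dots,N$, and let $I_N$ be the ideal generated by $\alpha_1,\dots,\alpha_N$. The homogenization of a polynomial $\alpha$ of degree $d$ is $\widehat\alpha(C_0,\dots,C_N)=C_0^{d}\,\alpha(C_1/C_0,\dots,C_N/C_0)$. The multiplicity of a solution $P\in\mathbb C^N$ of the system is $\dim_{\mathbb C}\big(\mathbb C[c_1,\dots,c_N]_P/(I_N)_P\big)$, where the subscript $P$ denotes localization at the maximal ideal of $P$. An Ulam polynomial of degree $N$ is a monic polynomial $x^N+\sum_{m=1}^N\gamma_mx^{N-m}$ with complex coefficients such that $x^N+\sum_{m=1}^N\gamma_mx^{N-m}=\prod_{n=1}^N(x-\gamma_n)$; equivalently, $(\gamma_1,\dots,\gamma_N)$ is a solution of $\alpha_1=\dots=\alpha_N=0$. $U_N$ is the set of Ulam polynomials of degree $N$. *)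

theory Defs
  imports
    "HOL-Algebra.Embedded_Algebras"
    "HOL-Library.Poly_Mapping"
    "HOL-Library.Extended_Nat"
    "HOL-Library.FuncSet"
    "HOL-Computational_Algebra.Fraction_Field"
    "HOL-Computational_Algebra.Polynomial"
begin

section \<open>Polynomials in several variables\<close>

text \<open>Polynomials in the variables indexed by all natural numbers: finitely supported families of
  coefficients, indexed by monomials, which are finitely supported families of exponents. The ring
  in a given finite set of variables is a subset of this type, turned into a ring record below.\<close>

type_synonym monom = "nat \<Rightarrow>\<^sub>0 nat"
type_synonym mpoly = "monom \<Rightarrow>\<^sub>0 complex"

definition Var :: "nat \<Rightarrow> mpoly" where
  "Var i = Poly_Mapping.single (Poly_Mapping.single i 1) 1"

definition Const :: "complex \<Rightarrow> mpoly" where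
  "Const a = Poly_Mapping.single 0 a"

definition mdeg :: "monom \<Rightarrow> nat" where
  "mdeg m = (\<Sum>i\<in>Poly_Mapping.keys m. Poly_Mapping.lookup m i)"

definition total_degree :: "mpoly \<Rightarrow> nat" where
  "total_degree p = Max (insert 0 (mdeg ` Poly_Mapping.keys p))"

definition eval_monom :: "(nat \<Rightarrow> complex) \<Rightarrow> monom \<Rightarrow> complex" where
  "eval_monom P m = (\<Prod>i\<in>Poly_Mapping.keys m. P i ^ Poly_Mapping.lookup m i)"

definition eval_mpoly :: "(nat \<Rightarrow> complex) \<Rightarrow> mpoly \<Rightarrow> complex" where
  "eval_mpoly P p = (\<Sum>m\<in>Poly_Mapping.keys p. Poly_Mapping.lookup p m * eval_monom P m)"

definition polys_in :: "nat set \<Rightarrow> mpoly set" where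
  "polys_in V = {p. \<forall>m\<in>Poly_Mapping.keys p. Poly_Mapping.keys m \<subseteq> V}"

text \<open>The ring record on a subset of a type-class ring.\<close>

definition ring_on :: "'a::comm_ring_1 set \<Rightarrow> 'a ring" where
  "ring_on S = \<lparr>carrier = S, monoid.mult = (*), one = 1, zero = 0, add = (+)\<rparr>"

definition mpoly_ring :: "nat set \<Rightarrow> mpoly ring" where
  "mpoly_ring V = ring_on (polys_in V)"

definition is_radical :: "('a, 'b) ring_scheme \<Rightarrow> 'a set \<Rightarrow> bool" where
  "is_radical R I \<longleftrightarrow> (\<forall>f\<in>carrier R. \<forall>n::nat. f [^]\<^bsub>R\<^esub> n \<in> I \<longrightarrow> f \<in> I)"

text \<open>The affine variables are \<open>c\<^sub>1, \<dots>, c\<^sub>N\<close>; variable \<open>0\<close> is the homogenizing variable \<open>C\<^sub>0\<close>.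
  A monomial \<open>m\<close> of a polynomial of degree \<open>d\<close> becomes \<open>C\<^sub>0\<^sup>d (C\<^sub>1/C\<^sub>0, \<dots>)\<^sup>m\<close>, that is, \<open>m\<close> times
  the power \<open>d - mdeg m\<close> of \<open>C\<^sub>0\<close>; see \<open>eval_homogenize\<close>.\<close>

definition homogenize :: "mpoly \<Rightarrow> mpoly" where
  "homogenize p = (\<Sum>m\<in>Poly_Mapping.keys p.
     Poly_Mapping.single (m + Poly_Mapping.single 0 (total_degree p - mdeg m)) (Poly_Mapping.lookup p m))"


section \<open>Local rings and multiplicities\<close>

text \<open>The localization of \<open>\<complex>[c\<^sub>1, \<dots>, c\<^sub>N]\<close> at a point \<open>P\<close>, inside the field of fractions. The type
  \<open>mpoly fract\<close> has fractions in all variables; only the subring below is used.\<close>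

definition max_ideal_at :: "nat \<Rightarrow> (nat \<Rightarrow> complex) \<Rightarrow> mpoly set" where
  "max_ideal_at N P = {f \<in> polys_in {1..N}. eval_mpoly P f = 0}"

definition local_ring :: "nat \<Rightarrow> (nat \<Rightarrow> complex) \<Rightarrow> mpoly fract ring" where
  "local_ring N P =
     ring_on {Fract f g | f g. f \<in> polys_in {1..N} \<and> g \<in> polys_in {1..N} - max_ideal_at N P}"

definition local_ideal :: "nat \<Rightarrow> (nat \<Rightarrow> complex) \<Rightarrow> mpoly set \<Rightarrow> mpoly fract set" where
  "local_ideal N P I = Idl\<^bsub>local_ring N P\<^esub> ((\<lambda>f. Fract f 1) ` I)"

text \<open>The quotient is a complex vector space through the image of the constants. Infinite dimension
  is recorded as \<open>\<infinity>\<close>.\<close>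

definition local_multiplicity :: "nat \<Rightarrow> mpoly set \<Rightarrow> (nat \<Rightarrow> complex) \<Rightarrow> enat" where
  "local_multiplicity N I P =
     (let L = local_ring N P; J = local_ideal N P I; Q = L Quot J;
          K = (\<lambda>a. J +>\<^bsub>L\<^esub> Fract (Const a) 1) ` UNIV
      in if ring.finite_dimension Q K (carrier Q) then enat (ring.dim Q K (carrier Q)) else \<infinity>)"


section \<open>Ulam polynomials\<close>

definition elem_sym :: "nat \<Rightarrow> nat \<Rightarrow> mpoly" where
  "elem_sym N j = (\<Sum>A | A \<subseteq> {1..N} \<and> card A = j. \<Prod>i\<in>A. Var i)"

definition alpha :: "nat \<Rightarrow> nat \<Rightarrow> mpoly" where
  "alpha N j = elem_sym N j - (-1) ^ j * Var j"

definition ulam_ideal :: "nat \<Rightarrow> mpoly set" where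
  "ulam_ideal N = Idl\<^bsub>mpoly_ring {1..N}\<^esub> (alpha N ` {1..N})"

definition ulam_hom_ideal :: "nat \<Rightarrow> mpoly set" where
  "ulam_hom_ideal N = Idl\<^bsub>mpoly_ring {0..N}\<^esub> ((\<lambda>j. homogenize (alpha N j)) ` {1..N})"

text \<open>Points of \<open>\<complex>\<^sup>N\<close> are functions on \<open>{1..N}\<close>, extended by \<open>undefined\<close>.\<close>

definition ulam_solutions :: "nat \<Rightarrow> (nat \<Rightarrow> complex) set" where
  "ulam_solutions N =
     {P \<in> {1..N} \<rightarrow>\<^sub>E UNIV. \<forall>j\<in>{1..N}. eval_mpoly P (alpha N j) = 0}"

definition ulam_polys :: "nat \<Rightarrow> complex Polynomial.poly set" where
  "ulam_polys N = {p. \<exists>\<gamma> :: nat \<Rightarrow> complex.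
     p = Polynomial.monom 1 N + (\<Sum>m=1..N. Polynomial.monom (\<gamma> m) (N - m)) \<and>
     p = (\<Prod>n=1..N. [:- \<gamma> n, 1:])}"


section \<open>Consistency of the definitions\<close>

lemma eval_mpoly_superset:
  assumes "finite S" "Poly_Mapping.keys p \<subseteq> S"
  shows "eval_mpoly P p = (\<Sum>m\<in>S. Poly_Mapping.lookup p m * eval_monom P m)"
  unfolding eval_mpoly_def
  by (rule sum.mono_neutral_left) (use assms in \<open>auto simp: in_keys_iff\<close>)

lemma eval_mpoly_0 [simp]: "eval_mpoly P 0 = 0"
  by (simp add: eval_mpoly_def)

lemma eval_mpoly_add: "eval_mpoly P (p + q) = eval_mpoly P p + eval_mpoly P q"
proof -
  let ?S = "Poly_Mapping.keys p \<union> Poly_Mapping.keys q"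
  show ?thesis
    using Poly_Mapping.keys_add[of p q]
    by (simp add: eval_mpoly_superset[of ?S] lookup_add distrib_right sum.distrib)
qed

lemma eval_mpoly_sum: "eval_mpoly P (sum f A) = (\<Sum>x\<in>A. eval_mpoly P (f x))"
  by (induction A rule: infinite_finite_induct) (auto simp: eval_mpoly_add)

lemma eval_mpoly_single: "eval_mpoly P (Poly_Mapping.single m a) = a * eval_monom P m"
  by (simp add: eval_mpoly_superset[of "{m}"])

lemma eval_monom_superset:
  assumes "finite S" "Poly_Mapping.keys m \<subseteq> S"
  shows "eval_monom P m = (\<Prod>i\<in>S. P i ^ Poly_Mapping.lookup m i)"
  unfolding eval_monom_def
  by (rule prod.mono_neutral_left) (use assms in \<open>auto simp: in_keys_iff\<close>)

lemma eval_monom_add: "eval_monom P (m + n) = eval_monom P m * eval_monom P n"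
proof -
  let ?S = "Poly_Mapping.keys m \<union> Poly_Mapping.keys n"
  show ?thesis
    using Poly_Mapping.keys_add[of m n]
    by (simp add: eval_monom_superset[of ?S] lookup_add power_add prod.distrib)
qed

lemma eval_monom_single: "eval_monom P (Poly_Mapping.single i k) = P i ^ k"
  by (simp add: eval_monom_superset[of "{i}"])

lemma eval_Var: "eval_mpoly P (Var i) = P i"
  by (simp add: Var_def eval_mpoly_single eval_monom_single)

lemma eval_Const: "eval_mpoly P (Const a) = a"
  by (simp add: Const_def eval_mpoly_single eval_monom_def)

lemma eval_mpoly_mult: "eval_mpoly P (p * q) = eval_mpoly P p * eval_mpoly P q"
proof -
  have expand: "r = (\<Sum>m\<in>Poly_Mapping.keys r. Poly_Mapping.single m (Poly_Mapping.lookup r m))"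
    for r :: mpoly
    by (rule poly_mapping_eqI) (simp add: lookup_sum lookup_single when_def in_keys_iff)
  have "p * q = (\<Sum>m\<in>Poly_Mapping.keys p. \<Sum>n\<in>Poly_Mapping.keys q.
      Poly_Mapping.single (m + n) (Poly_Mapping.lookup p m * Poly_Mapping.lookup q n))"
    by (subst expand[of p], subst expand[of q]) (simp add: sum_product mult_single)
  then show ?thesis
    by (simp add: eval_mpoly_sum eval_mpoly_single eval_monom_add)
       (simp add: eval_mpoly_def sum_product mult_ac)
qed

lemma mdeg_le_total_degree: "m \<in> Poly_Mapping.keys p \<Longrightarrow> mdeg m \<le> total_degree p"
  by (simp add: total_degree_def)

lemma eval_homogenize:
  assumes "C 0 \<noteq> 0"
  shows "eval_mpoly C (homogenize p) = C 0 ^ total_degree p * eval_mpoly (\<lambda>i. C i / C 0) p"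
proof -
  have scale: "eval_monom (\<lambda>i. C i / C 0) m = eval_monom C m / C 0 ^ mdeg m" for m
    by (simp add: eval_monom_def mdeg_def power_divide prod_dividef power_sum)
  show ?thesis
    unfolding homogenize_def eval_mpoly_sum eval_mpoly_single eval_monom_add eval_monom_single
    by (simp add: eval_mpoly_def scale sum_distrib_left mdeg_le_total_degree power_diff assms mult_ac)
qed

lemma cring_ring_on:
  assumes "0 \<in> S" "1 \<in> S" "\<And>x y. x \<in> S \<Longrightarrow> y \<in> S \<Longrightarrow> x + y \<in> S"
    "\<And>x y. x \<in> S \<Longrightarrow> y \<in> S \<Longrightarrow> x * y \<in> S" "\<And>x. x \<in> S \<Longrightarrow> - x \<in> S"
  shows "cring (ring_on S)"
proof (rule cringI)
  show "abelian_group (ring_on S)"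
    by (rule abelian_groupI) (use assms in \<open>auto simp: ring_on_def add_ac intro: bexI[of _ "- x" for x]\<close>)
  show "comm_monoid (ring_on S)"
    by (rule comm_monoidI) (use assms in \<open>auto simp: ring_on_def mult_ac\<close>)
qed (auto simp: ring_on_def distrib_right)

lemma
  shows polys_in_0: "0 \<in> polys_in V" and polys_in_1: "1 \<in> polys_in V"
    and Const_in_polys_in: "Const a \<in> polys_in V"
    and Var_in_polys_in: "i \<in> V \<Longrightarrow> Var i \<in> polys_in V"
  by (auto simp: polys_in_def Const_def Var_def simp flip: single_one split: if_splits)

lemma polys_in_add: "p \<in> polys_in V \<Longrightarrow> q \<in> polys_in V \<Longrightarrow> p + q \<in> polys_in V"
  using Poly_Mapping.keys_add[of p q] by (auto simp: polys_in_def)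

lemma polys_in_mult:
  assumes "p \<in> polys_in V" "q \<in> polys_in V"
  shows "p * q \<in> polys_in V"
  unfolding polys_in_def
proof (intro CollectI ballI)
  fix k assume "k \<in> Poly_Mapping.keys (p * q)"
  then obtain m n where "k = m + n" "m \<in> Poly_Mapping.keys p" "n \<in> Poly_Mapping.keys q"
    using Poly_Mapping.keys_mult[of p q] by blast
  with assms Poly_Mapping.keys_add[of m n] show "Poly_Mapping.keys k \<subseteq> V"
    unfolding polys_in_def by blast
qed

lemma polys_in_uminus: "p \<in> polys_in V \<Longrightarrow> - p \<in> polys_in V"
  by (simp add: polys_in_def in_keys_iff)

lemma cring_mpoly_ring: "cring (mpoly_ring V)"
  unfolding mpoly_ring_def
  by (rule cring_ring_on) (auto intro: polys_in_0 polys_in_1 polys_in_add polys_in_mult polys_in_uminus)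

lemma cring_local_ring: "cring (local_ring N P)"
proof -
  let ?D = "polys_in {1..N} - max_ideal_at N P"
  let ?S = "{Fract f g | f g. f \<in> polys_in {1..N} \<and> g \<in> ?D}"
  have one: "1 \<in> ?D"
    using eval_Const[of P 1] by (simp add: polys_in_1 max_ideal_at_def Const_def)
  have mult: "g * h \<in> ?D" if "g \<in> ?D" "h \<in> ?D" for g h
    using that by (auto simp: max_ideal_at_def eval_mpoly_mult polys_in_mult)
  have nz: "g \<noteq> 0" if "g \<in> ?D" for g
    using that by (auto simp: max_ideal_at_def)
  have SI: "Fract f g \<in> ?S" if "f \<in> polys_in {1..N}" "g \<in> ?D" for f g
    using that by blast
  show ?thesis
    unfolding local_ring_def
  proof (rule cring_ring_on)
    show "0 \<in> ?S"
      unfolding Zero_fract_def by (rule SI[OF polys_in_0 one])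
    show "1 \<in> ?S"
      unfolding One_fract_def by (rule SI[OF polys_in_1 one])
  next
    fix x y assume "x \<in> ?S" "y \<in> ?S"
    then obtain f g h k where xy: "x = Fract f g" "y = Fract h k"
      "f \<in> polys_in {1..N}" "g \<in> ?D" "h \<in> polys_in {1..N}" "k \<in> ?D" by blast
    have "f * k + h * g \<in> polys_in {1..N}"
      using xy by (intro polys_in_add polys_in_mult) auto
    then show "x + y \<in> ?S"
      using SI[OF _ mult[OF xy(4,6)]] xy nz by simp
    show "x * y \<in> ?S"
      using SI[OF polys_in_mult[OF xy(3,5)] mult[OF xy(4,6)]] xy by simp
  next
    fix x assume "x \<in> ?S"
    then obtain f g where xy: "x = Fract f g" "f \<in> polys_in {1..N}" "g \<in> ?D" by blast
    show "- x \<in> ?S"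
      using SI[OF polys_in_uminus[OF xy(2)] xy(3)] xy by simp
  qed
qed

end

(* The curve c(t) = (1, -1-t, -1, t, 0, ..., 0) satisfies all equations up to t^2 and passes for t = 0
   through the solution P = (1, -1, -1, 0, ..., 0). Hence all elements of the ideal vanish at P together
   with their derivatives along the curve, whereas c_4 has derivative 1: so 1 and c_4 are independent in
   the local ring at P modulo the ideal.

   The equations turn the relations between elementary and complete symmetric polynomials into
   relations with leading terms c_k^(N-k+1), so the N! monomials with exponents m_k <= N-k span
   C[c]/I_N. Evaluation at N! solutions, one of them P, together with the derivative at P would be
   N!+1 independent functionals on this space.

   By finiteness some nonzero polynomial in c_4 lies in I_N, so a power of some f = c_4 q(c_4) with
   q(0) <> 0 does. Then a power of C_0^s f^ lies in the homogenized ideal for large s, where f^ is the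
   homogenization of f, but C_0^s f^ does not: its derivative along the curve is q(0). *)

theory Submission
  imports Defs
begin

section \<open>Evaluation, constants, and polynomials in a given set of variables\<close>

lemma mpoly_eq_sum_single:
  fixes p :: "'a \<Rightarrow>\<^sub>0 'b::comm_monoid_add"
  shows "p = (\<Sum>m\<in>Poly_Mapping.keys p. Poly_Mapping.single m (Poly_Mapping.lookup p m))"
  by (rule poly_mapping_eqI) (simp add: lookup_sum lookup_single when_def in_keys_iff)

lemma eval_mpoly_cong:
  assumes "f \<in> polys_in V" "\<And>i. i \<in> V \<Longrightarrow> P i = Q i"
  shows "eval_mpoly P f = eval_mpoly Q f"
proof -
  have "eval_monom P m = eval_monom Q m" if "m \<in> Poly_Mapping.keys f" for m
    unfolding eval_monom_def
    by (rule prod.cong) (use that assms in \<open>auto simp: polys_in_def subset_iff\<close>)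
  then show ?thesis
    by (simp add: eval_mpoly_def)
qed

lemma Const_add: "Const (a + b) = Const a + Const b"
  and Const_mult: "Const (a * b) = Const a * Const b"
  and Const_0 [simp]: "Const 0 = 0"
  and Const_1 [simp]: "Const 1 = 1"
  by (simp_all add: Const_def single_add mult_single)

lemma lookup_Const_mult: "Poly_Mapping.lookup (Const a * p) m = a * Poly_Mapping.lookup p m"
proof -
  have "Const a * p = (\<Sum>k\<in>Poly_Mapping.keys p. Poly_Mapping.single k (a * Poly_Mapping.lookup p k))"
    by (subst mpoly_eq_sum_single[of p]) (simp add: Const_def sum_distrib_left mult_single)
  then show ?thesis
    by (simp add: lookup_sum lookup_single when_def in_keys_iff)
qed

lemma eval_uminus: "eval_mpoly P (- f) = - eval_mpoly P f"
  using eval_mpoly_add[of P f "- f"] by (simp add: eq_neg_iff_add_eq_0 add.commute)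

lemma eval_diff: "eval_mpoly P (f - g) = eval_mpoly P f - eval_mpoly P g"
  using eval_mpoly_add[of P f "- g"] by (simp add: eval_uminus)

lemma eval_1 [simp]: "eval_mpoly P 1 = 1"
  using eval_Const[of P 1] by simp

lemma eval_prod: "eval_mpoly P (prod f A) = (\<Prod>x\<in>A. eval_mpoly P (f x))"
  by (induction A rule: infinite_finite_induct) (auto simp: eval_mpoly_mult)

lemma eval_power: "eval_mpoly P (f ^ n) = eval_mpoly P f ^ n"
  by (induction n) (auto simp: eval_mpoly_mult)

lemma polys_in_diff: "p \<in> polys_in V \<Longrightarrow> q \<in> polys_in V \<Longrightarrow> p - q \<in> polys_in V"
  using polys_in_add[OF _ polys_in_uminus, of p V q] by simp

lemma polys_in_sum: "(\<And>x. x \<in> A \<Longrightarrow> f x \<in> polys_in V) \<Longrightarrow> sum f A \<in> polys_in V"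
  by (induction A rule: infinite_finite_induct) (auto simp: polys_in_0 polys_in_add)

lemma polys_in_prod: "(\<And>x. x \<in> A \<Longrightarrow> f x \<in> polys_in V) \<Longrightarrow> prod f A \<in> polys_in V"
  by (induction A rule: infinite_finite_induct) (auto simp: polys_in_1 polys_in_mult)

lemma polys_in_power: "f \<in> polys_in V \<Longrightarrow> f ^ n \<in> polys_in V"
  by (induction n) (auto simp: polys_in_1 polys_in_mult)

lemma polys_in_single: "Poly_Mapping.keys m \<subseteq> V \<Longrightarrow> Poly_Mapping.single m a \<in> polys_in V"
  by (auto simp: polys_in_def)

lemma polys_in_alpha:
  assumes "j \<in> {1..N}"
  shows "alpha N j \<in> polys_in {1..N}"
proof -
  have "(-1) ^ j * Var j \<in> polys_in {1..N}"
    using assms by (intro polys_in_mult polys_in_power polys_in_uminus polys_in_1 Var_in_polys_in)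
  moreover have "elem_sym N j \<in> polys_in {1..N}"
    unfolding elem_sym_def by (intro polys_in_sum polys_in_prod Var_in_polys_in) auto
  ultimately show ?thesis
    unfolding alpha_def by (rule polys_in_diff[rotated])
qed

section \<open>A curve tangent to all the equations\<close>

text \<open>Vieta's formula for the reversed product, in which \<open>s_j\<close> sits at index
  \<open>j\<close> instead of \<open>N - j\<close>. The ring is general because the formula is
  applied both to complex values and to the variables themselves.\<close>

lemma coeff_prod_one_minus:
  fixes x :: "'i \<Rightarrow> 'a::comm_ring_1"
  assumes "finite A"
  shows "coeff (\<Prod>i\<in>A. [:1, - x i:]) j = (-1) ^ j * (\<Sum>B | B \<subseteq> A \<and> card B = j. \<Prod>i\<in>B. x i)"
proof -
  have monom_prod: "(\<Prod>i\<in>B. monom (x i) 1) = monom (\<Prod>i\<in>B. x i) (card B)" if "finite B" for B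
    using that by induction (auto simp: mult_monom)
  have "(\<Prod>i\<in>A. [:1, - x i:]) = (\<Prod>i\<in>A. 1 - monom (x i) 1)"
    by (intro prod.cong refl) (simp add: monom_Suc monom_0 one_pCons)
  also have "\<dots> = (\<Sum>B\<in>Pow A. (-1) ^ card B * (\<Prod>i\<in>B. monom (x i) 1))"
    using assms by (simp add: prod_diff_conv_sum)
  also have "\<dots> = (\<Sum>B\<in>Pow A. (-1) ^ card B * monom (\<Prod>i\<in>B. x i) (card B))"
    using assms by (intro sum.cong refl arg_cong2[of _ _ _ _ "(*)"] monom_prod) (auto intro: finite_subset)
  also have "coeff \<dots> j = (\<Sum>B\<in>Pow A. if card B = j then (-1) ^ j * (\<Prod>i\<in>B. x i) else 0)"
    unfolding coeff_sum
  proof (intro sum.cong refl)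
    fix B
    have "((-1) ^ k :: 'a poly) = [:(-1) ^ k:]" for k
      by (induction k) (auto simp: one_pCons)
    then show "coeff ((-1) ^ card B * monom (\<Prod>i\<in>B. x i) (card B)) j =
      (if card B = j then (-1) ^ j * (\<Prod>i\<in>B. x i) else 0)"
      by auto
  qed
  also have "\<dots> = (\<Sum>B | B \<subseteq> A \<and> card B = j. (-1) ^ j * (\<Prod>i\<in>B. x i))"
    using assms by (simp add: sum.If_cases Pow_def Int_def conj_commute)
  finally show ?thesis
    by (simp add: sum_distrib_left)
qed

text \<open>Pulling out the sign turns the \<open>j\<close>-th equation into a comparison of the
  point with the coefficients of its reversed product.\<close>

lemma eval_alpha:
  "eval_mpoly P (alpha N j) = (-1) ^ j * (coeff (\<Prod>i=1..N. [:1, - P i:]) j - P j)"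
proof -
  have "eval_mpoly P ((-1) ^ j * Var j) = (-1) ^ j * P j"
    by (simp add: eval_mpoly_mult eval_power eval_uminus eval_Var)
  then show ?thesis
    by (simp add: coeff_prod_one_minus alpha_def elem_sym_def eval_diff eval_mpoly_sum eval_prod
        eval_Var right_diff_distrib flip: mult.assoc power_mult_distrib)
qed

text \<open>The first four coordinates are the roots of
  \<open>(x\<^sup>2 - 1)(x + 1 + t)(x - t) = x\<^sup>4 + x\<^sup>3 - (1 + t + t\<^sup>2) x\<^sup>2 - x + (t + t\<^sup>2)\<close>, so that roots and
  coefficients agree up to \<open>t\<^sup>2\<close>. The value 1 at index 0 is that of the homogenizing variable.\<close>

definition tangent_curve :: "complex \<Rightarrow> nat \<Rightarrow> complex" where
  "tangent_curve t i =
     (if i \<le> 1 then 1 else if i = 2 then - 1 - t else if i = 3 then - 1 else if i = 4 then t else 0)"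

text \<open>Coordinates beyond the fourth contribute factors 1 to the reversed product, so a quartic
  remains; its coefficients differ from the coordinates only at indices 2 and 4.\<close>

lemma tangent_curve_alpha:
  assumes "N \<ge> 4" "j \<ge> 1"
  shows "eval_mpoly (tangent_curve t) (alpha N j) =
    (if j = 2 then - t\<^sup>2 else if j = 4 then t\<^sup>2 else 0)"
proof -
  have "(\<Prod>i=1..N. [:1, - tangent_curve t i:]) = (\<Prod>i=1..4. [:1, - tangent_curve t i:])"
    using assms by (intro prod.mono_neutral_right) (auto simp: tangent_curve_def one_pCons)
  also have "{1..4} = {1, 2, 3, 4::nat}"
    by auto
  also have "(\<Prod>i\<in>\<dots>. [:1, - tangent_curve t i:]) = [:1, 1, - 1 - t - t\<^sup>2, -1, t + t\<^sup>2:]"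
    by (simp add: tangent_curve_def) (simp add: algebra_simps power2_eq_square)
  finally show ?thesis
    using assms(2) by (auto simp: eval_alpha tangent_curve_def coeff_pCons split: nat.split)
qed

text \<open>The kernel of restriction to the curve modulo \<open>t^2\<close>, a ring homomorphism
  into the dual numbers; hence it behaves like an ideal.\<close>

definition flat :: "mpoly \<Rightarrow> bool" where
  "flat f \<longleftrightarrow> eval_mpoly (tangent_curve 0) f = 0 \<and>
     ((\<lambda>t. eval_mpoly (tangent_curve t) f) has_field_derivative 0) (at 0)"

text \<open>The coordinates are affine in \<open>t\<close>. This supplies the derivatives of
  arbitrary factors in the product rule.\<close>

lemma eval_tangent_curve_differentiable:
  obtains d where "((\<lambda>t. eval_mpoly (tangent_curve t) f) has_field_derivative d) (at 0)"
proof -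
  have power: "\<exists>d. ((\<lambda>t. tangent_curve t i ^ n) has_field_derivative d) (at 0)" for i n
  proof -
    have line: "(\<lambda>t. tangent_curve t i) =
        (\<lambda>t. tangent_curve 0 i + (if i = 2 then - 1 else if i = 4 then 1 else 0) * t)"
      by (auto simp: tangent_curve_def)
    have "((\<lambda>t. tangent_curve t i) has_field_derivative
        (if i = 2 then - 1 else if i = 4 then 1 else 0)) (at 0)"
      unfolding line by (auto intro!: derivative_eq_intros)
    from DERIV_power[OF this, of n] show ?thesis
      by (rule exI)
  qed
  have prod: "\<exists>d. ((\<lambda>t. \<Prod>i\<in>A. tangent_curve t i ^ n i) has_field_derivative d) (at 0)"
    if "finite A" for A n
    using that
  proof induction
    case (insert i A)
    with power[of i "n i"] show ?case
      by (auto intro: DERIV_mult)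
  qed (auto intro: exI[of _ 0])
  have "\<exists>d. ((\<lambda>t. \<Sum>m\<in>M. Poly_Mapping.lookup f m * eval_monom (tangent_curve t) m)
      has_field_derivative d) (at 0)" if "finite M" for M
    using that
  proof induction
    case (insert m M)
    from prod[of "Poly_Mapping.keys m" "Poly_Mapping.lookup m"]
    obtain d where "((\<lambda>t. eval_monom (tangent_curve t) m) has_field_derivative d) (at 0)"
      by (auto simp: eval_monom_def)
    note d = DERIV_cmult[OF this, of "Poly_Mapping.lookup f m"]
    from insert.IH obtain e where "((\<lambda>t. \<Sum>m\<in>M. Poly_Mapping.lookup f m * eval_monom (tangent_curve t) m)
        has_field_derivative e) (at 0)"
      by blast
    from DERIV_add[OF d this] insert show ?case
      by auto
  qed (auto intro: exI[of _ 0])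
  from this[of "Poly_Mapping.keys f"] show thesis
    using that by (auto simp: eval_mpoly_def)
qed

lemma flat_0: "flat 0"
  by (simp add: flat_def)

lemma flat_add: "flat f \<Longrightarrow> flat g \<Longrightarrow> flat (f + g)"
  unfolding flat_def eval_mpoly_add by (auto intro!: derivative_eq_intros)

lemma flat_uminus: "flat f \<Longrightarrow> flat (- f)"
  unfolding flat_def eval_uminus by (auto intro!: derivative_eq_intros)

lemma flat_mult:
  assumes "flat f"
  shows "flat (f * g)"
proof -
  obtain d where "((\<lambda>t. eval_mpoly (tangent_curve t) g) has_field_derivative d) (at 0)"
    by (rule eval_tangent_curve_differentiable)
  with assms show ?thesis
    unfolding flat_def eval_mpoly_mult by (auto intro!: derivative_eq_intros)
qed

text \<open>Since \<open>g\<close> does not vanish at \<open>t = 0\<close>, \<open>f\<close> does;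
  the product rule then leaves only the derivative of \<open>f\<close> times the value of
  \<open>g\<close>. This cancels denominators and interpolating factors later.\<close>

lemma flat_multD:
  assumes "flat (f * g)" "eval_mpoly (tangent_curve 0) g \<noteq> 0"
  shows "flat f"
proof -
  obtain d where d: "((\<lambda>t. eval_mpoly (tangent_curve t) f) has_field_derivative d) (at 0)"
    by (rule eval_tangent_curve_differentiable)
  obtain e where e: "((\<lambda>t. eval_mpoly (tangent_curve t) g) has_field_derivative e) (at 0)"
    by (rule eval_tangent_curve_differentiable)
  have f0: "eval_mpoly (tangent_curve 0) f = 0"
    using assms by (simp add: flat_def eval_mpoly_mult)
  have "((\<lambda>t. eval_mpoly (tangent_curve t) (f * g)) has_field_derivative
      d * eval_mpoly (tangent_curve 0) g) (at 0)"
    unfolding eval_mpoly_mult using d e f0 by (auto intro!: derivative_eq_intros)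
  then have "d * eval_mpoly (tangent_curve 0) g = 0"
    using assms(1) unfolding flat_def by (blast intro: DERIV_unique)
  with assms(2) d f0 show ?thesis
    by (simp add: flat_def)
qed

text \<open>The source of all independence claims: no nontrivial combination of 1 and
  \<open>c_4\<close>, which equals \<open>t\<close> on the curve, is flat.\<close>

lemma flat_tangent:
  assumes "flat f" "\<And>t. eval_mpoly (tangent_curve t) f = a + b * t"
  shows "a = 0" "b = 0"
proof -
  show "a = 0"
    using assms by (simp add: flat_def)
  have "((\<lambda>t. a + b * t) has_field_derivative b) (at 0)"
    by (auto intro!: derivative_eq_intros)
  with assms show "b = 0"
    unfolding flat_def by (metis (no_types, lifting) DERIV_unique ext)
qed

lemma flat_alpha:
  assumes "N \<ge> 4" "j \<ge> 1"
  shows "flat (alpha N j)"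
  unfolding flat_def using assms
  by (auto simp: tangent_curve_alpha intro!: derivative_eq_intros)

section \<open>Ideals in rings given by their carriers\<close>

lemma ring_on_simps [simp]:
  "carrier (ring_on S) = S" "x \<otimes>\<^bsub>ring_on S\<^esub> y = x * y" "x \<oplus>\<^bsub>ring_on S\<^esub> y = x + y"
  "\<one>\<^bsub>ring_on S\<^esub> = 1" "\<zero>\<^bsub>ring_on S\<^esub> = 0"
  by (simp_all add: ring_on_def)

lemma ring_on_uminus:
  assumes "cring (ring_on S)" "x \<in> S" "- x \<in> S"
  shows "\<ominus>\<^bsub>ring_on S\<^esub> x = - x"
proof -
  interpret cring "ring_on S" by fact
  show ?thesis
    by (rule minus_equality) (use assms in auto)
qed

lemma ideal_ring_onI:
  assumes "cring (ring_on S)" "J \<subseteq> S" "0 \<in> J"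
    "\<And>x y. x \<in> J \<Longrightarrow> y \<in> J \<Longrightarrow> x + y \<in> J" "\<And>x. x \<in> J \<Longrightarrow> - x \<in> J"
    "\<And>x y. x \<in> S \<Longrightarrow> y \<in> J \<Longrightarrow> x * y \<in> J"
  shows "ideal J (ring_on S)"
proof -
  interpret cring "ring_on S" by fact
  show ?thesis
  proof (rule idealI)
    show "subgroup J (add_monoid (ring_on S))"
      by (rule add.subgroupI) (use assms in \<open>auto simp: ring_on_uminus subset_iff\<close>)
    show "a \<otimes>\<^bsub>ring_on S\<^esub> x \<in> J" if "a \<in> J" "x \<in> carrier (ring_on S)" for a x
      using assms(6)[of x a] that by (simp add: mult.commute)
  qed (use assms in \<open>auto simp: ring_axioms\<close>)
qed

lemma ideal_ring_onD:
  assumes "ideal J (ring_on S)"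
  shows "J \<subseteq> S" "0 \<in> J" "x \<in> J \<Longrightarrow> y \<in> J \<Longrightarrow> x + y \<in> J" "x \<in> S \<Longrightarrow> y \<in> J \<Longrightarrow> x * y \<in> J"
proof -
  interpret ideal J "ring_on S" by fact
  show "J \<subseteq> S"
    using a_subset by simp
  show "0 \<in> J"
    using additive_subgroup.zero_closed[OF is_additive_subgroup] by simp
  show "x + y \<in> J" if "x \<in> J" "y \<in> J"
    using additive_subgroup.a_closed[OF is_additive_subgroup that] by simp
  show "x * y \<in> J" if "x \<in> S" "y \<in> J"
    using I_l_closed[of y x] that by simp
qed

lemma ulam_ideal_ideal: "ideal (ulam_ideal N) (ring_on (polys_in {1..N}))"
  and alpha_in_ulam_ideal: "j \<in> {1..N} \<Longrightarrow> alpha N j \<in> ulam_ideal N"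
proof -
  interpret cring "mpoly_ring {1..N}" by (rule cring_mpoly_ring)
  have carr: "alpha N ` {1..N} \<subseteq> carrier (mpoly_ring {1..N})"
    using polys_in_alpha by (auto simp: mpoly_ring_def)
  show "ideal (ulam_ideal N) (ring_on (polys_in {1..N}))"
    using genideal_ideal[OF carr] by (simp add: ulam_ideal_def mpoly_ring_def)
  show "alpha N j \<in> ulam_ideal N" if "j \<in> {1..N}"
    using genideal_self[OF carr] that by (auto simp: ulam_ideal_def)
qed

lemma ulam_ideal_subsetI:
  assumes "ideal J (ring_on (polys_in {1..N}))" "\<And>j. j \<in> {1..N} \<Longrightarrow> alpha N j \<in> J"
  shows "ulam_ideal N \<subseteq> J"
proof -
  interpret cring "mpoly_ring {1..N}" by (rule cring_mpoly_ring)
  show ?thesis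
    unfolding ulam_ideal_def by (rule genideal_minimal) (use assms in \<open>auto simp: mpoly_ring_def\<close>)
qed

lemmas ulam_ideal_rules = ideal_ring_onD[OF ulam_ideal_ideal]

lemma ulam_ideal_sum: "(\<And>x. x \<in> A \<Longrightarrow> f x \<in> ulam_ideal N) \<Longrightarrow> sum f A \<in> ulam_ideal N"
  by (induction A rule: infinite_finite_induct) (auto simp: ulam_ideal_rules(2,3))

text \<open>The set of variables stays open because this ideal bounds both the affine ideal over
  \<open>{1..N}\<close> and the homogenized one over \<open>{0..N}\<close>.\<close>

lemma ideal_flat: "ideal {f \<in> polys_in V. flat f} (ring_on (polys_in V))"
proof (rule ideal_ring_onI)
  show "x * y \<in> {f \<in> polys_in V. flat f}" if "x \<in> polys_in V" "y \<in> {f \<in> polys_in V. flat f}" for x y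
    using that flat_mult[of y x] by (simp add: polys_in_mult mult.commute)
qed (use cring_mpoly_ring[of V] in
  \<open>auto simp: mpoly_ring_def polys_in_0 polys_in_add polys_in_uminus flat_0 flat_add flat_uminus\<close>)

lemma flat_ulam_ideal:
  assumes "N \<ge> 4" "f \<in> ulam_ideal N"
  shows "flat f"
proof -
  have "ulam_ideal N \<subseteq> {f \<in> polys_in {1..N}. flat f}"
    by (rule ulam_ideal_subsetI[OF ideal_flat]) (use assms(1) polys_in_alpha in \<open>auto intro: flat_alpha\<close>)
  with assms(2) show ?thesis
    by blast
qed

lemma eval_ulam_ideal:
  assumes "P \<in> ulam_solutions N" "f \<in> ulam_ideal N"
  shows "eval_mpoly P f = 0"
proof -
  have "ideal {f \<in> polys_in {1..N}. eval_mpoly P f = 0} (ring_on (polys_in {1..N}))"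
    by (rule ideal_ring_onI)
      (use cring_mpoly_ring[of "{1..N}"] in
        \<open>auto simp: mpoly_ring_def polys_in_0 polys_in_add polys_in_mult polys_in_uminus
          eval_mpoly_add eval_mpoly_mult eval_uminus\<close>)
  then have "ulam_ideal N \<subseteq> {f \<in> polys_in {1..N}. eval_mpoly P f = 0}"
    by (rule ulam_ideal_subsetI) (use assms(1) polys_in_alpha in \<open>auto simp: ulam_solutions_def\<close>)
  with assms(2) show ?thesis
    by blast
qed

section \<open>A solution of multiplicity larger than one\<close>

text \<open>The restriction is needed for membership in \<open>ulam_solutions\<close>, whose points
  are \<open>undefined\<close> outside \<open>{1..N}\<close>.\<close>

definition tangent_point :: "nat \<Rightarrow> nat \<Rightarrow> complex" where
  "tangent_point N = restrict (tangent_curve 0) {1..N}"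

lemma eval_tangent_point:
  "f \<in> polys_in {1..N} \<Longrightarrow> eval_mpoly (tangent_point N) f = eval_mpoly (tangent_curve 0) f"
  by (rule eval_mpoly_cong) (auto simp: tangent_point_def)

lemma tangent_point_solution:
  assumes "N \<ge> 4"
  shows "tangent_point N \<in> ulam_solutions N"
  using assms polys_in_alpha
  by (auto simp: ulam_solutions_def eval_tangent_point tangent_curve_alpha)
     (auto simp: tangent_point_def)

text \<open>Fractions with flat numerators form an ideal containing the local ideal, and modulo it 1
  and \<open>c_4\<close> are independent over the constants.\<close>

lemma local_multiplicity_tangent_point:
  assumes N: "N \<ge> 4"
  shows "local_multiplicity N (ulam_ideal N) (tangent_point N) > 1"
proof -
  let ?P = "tangent_point N"
  let ?V = "polys_in {1..N}"
  let ?D = "?V - max_ideal_at N ?P"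
  define S where "S = {Fract f g | f g. f \<in> ?V \<and> g \<in> ?D}"
  define L where "L = ring_on S"
  define J where "J = local_ideal N ?P (ulam_ideal N)"
  \<comment> \<open>One representation with a flat numerator suffices; \<open>flat_multD\<close>
    carries flatness over to other representations.\<close>
  define J0 where "J0 = {Fract f g | f g. f \<in> ?V \<and> g \<in> ?D \<and> flat f}"
  define \<iota> where "\<iota> a = Fract (Const a) 1" for a
  have L: "local_ring N ?P = L"
    by (simp add: local_ring_def L_def S_def)
  have D: "g \<in> ?D \<longleftrightarrow> g \<in> ?V \<and> eval_mpoly (tangent_curve 0) g \<noteq> 0" for g
    by (auto simp: max_ideal_at_def eval_tangent_point)
  have one: "1 \<in> ?D"
    unfolding D by (simp add: polys_in_1)
  have D_mult: "g * h \<in> ?D" if "g \<in> ?D" "h \<in> ?D" for g h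
    using that unfolding D by (simp add: polys_in_mult eval_mpoly_mult)
  have D_nz: "g \<noteq> 0" if "g \<in> ?D" for g
    using that unfolding D by auto
  interpret L: cring L
    using cring_local_ring[of N ?P] by (simp add: L)
  have Fract_S: "Fract f 1 \<in> S" if "f \<in> ?V" for f
    using that one by (auto simp: S_def)
  have J0I: "Fract f g \<in> J0" if "f \<in> ?V" "g \<in> ?D" "flat f" for f g
    using that by (auto simp: J0_def)
  have "ideal J0 L"
    unfolding L_def
  proof (rule ideal_ring_onI)
    show "cring (ring_on S)"
      using L.is_cring by (simp add: L_def)
    show "J0 \<subseteq> S"
      by (auto simp: J0_def S_def)
    show "0 \<in> J0"
      unfolding Zero_fract_def by (intro J0I polys_in_0 one flat_0)
  next
    fix x y assume "x \<in> J0" "y \<in> J0"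
    then obtain f g h k where xy: "x = Fract f g" "y = Fract h k"
      "f \<in> ?V" "g \<in> ?D" "flat f" "h \<in> ?V" "k \<in> ?D" "flat h"
      unfolding J0_def by blast
    have "Fract (f * k + h * g) (g * k) \<in> J0"
      using xy by (intro J0I polys_in_add polys_in_mult D_mult flat_add flat_mult) blast+
    then show "x + y \<in> J0"
      using xy D_nz by simp
  next
    fix x assume "x \<in> J0"
    then obtain f g where xy: "x = Fract f g" "f \<in> ?V" "g \<in> ?D" "flat f"
      unfolding J0_def by blast
    then show "- x \<in> J0"
      using J0I[of "- f" g] by (simp add: polys_in_uminus flat_uminus)
  next
    fix x y assume "x \<in> S" "y \<in> J0"
    then obtain f g h k where xy: "x = Fract f g" "y = Fract h k"
      "f \<in> ?V" "g \<in> ?D" "h \<in> ?V" "k \<in> ?D" "flat h"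
      unfolding J0_def S_def by blast
    have "Fract (h * f) (g * k) \<in> J0"
      using xy by (intro J0I polys_in_mult D_mult flat_mult)
    then show "x * y \<in> J0"
      using xy by (simp add: mult.commute)
  qed
  moreover have gens: "(\<lambda>f. Fract f 1) ` ulam_ideal N \<subseteq> J0"
    using J0I[OF _ one] flat_ulam_ideal[OF N] ulam_ideal_rules(1) by blast
  ultimately have "J \<subseteq> J0"
    unfolding J_def local_ideal_def L by (rule L.genideal_minimal)
  have "(\<lambda>f. Fract f 1) ` ulam_ideal N \<subseteq> carrier L"
    using Fract_S ulam_ideal_rules(1) by (auto simp: L_def)
  then have "ideal J L"
    unfolding J_def local_ideal_def L by (rule L.genideal_ideal)
  then interpret J: ideal J L .
  interpret Q: cring "L Quot J"
    by (rule J.quotient_is_cring[OF L.is_cring])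
  interpret \<pi>: ring_hom_ring L "L Quot J" "(+>\<^bsub>L\<^esub>) J"
    by (rule J.rcos_ring_hom_ring)
  have Var4: "Var 4 \<in> ?V"
    using N by (intro Var_in_polys_in) auto
  \<comment> \<open>Cross-multiplication makes the combination times \<open>g\<close> flat, and
    \<open>g\<close> is nonzero at the point, so it can be cancelled.\<close>
  have indep: "b = 0 \<and> a = 0" if mem: "Fract (Const b * Var 4 + Const a) 1 \<in> J" for a b
  proof -
    let ?h = "Const b * Var 4 + Const a"
    from mem \<open>J \<subseteq> J0\<close> obtain f g where fg: "Fract ?h 1 = Fract f g" "g \<in> ?D" "flat f"
      unfolding J0_def by blast
    then have "flat (?h * g)"
      using D_nz by (simp add: eq_fract)
    then have "flat ?h"
      by (rule flat_multD) (use fg D in blast)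
    then show ?thesis
      using flat_tangent[of ?h a b]
      by (simp add: eval_mpoly_add eval_mpoly_mult eval_Const eval_Var tangent_curve_def)
  qed
  have \<iota>_S: "\<iota> a \<in> S" for a
    unfolding \<iota>_def by (rule Fract_S[OF Const_in_polys_in])
  have \<iota>_add: "\<iota> a + \<iota> b = \<iota> (a + b)" and \<iota>_mult: "\<iota> a * \<iota> b = \<iota> (a * b)"
    and \<iota>_1: "\<iota> 1 = 1" and \<iota>_0: "\<iota> 0 = 0" for a b
    by (simp_all add: \<iota>_def Const_add Const_mult One_fract_def Zero_fract_def)
  let ?K = "(\<lambda>a. J +>\<^bsub>L\<^esub> \<iota> a) ` UNIV"
  have zero_iff: "J +>\<^bsub>L\<^esub> x = \<zero>\<^bsub>L Quot J\<^esub> \<longleftrightarrow> x \<in> J" if "x \<in> S" for x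
    using that J.rcos_const_imp_mem[of x] J.a_rcos_const[of x]
    by (auto simp: FactRing_def L_def)
  have "subfield (range \<iota>) L"
  proof (rule L.subfieldI)
    have "subring (range \<iota>) L"
    proof (rule L.subringI)
      fix x assume "x \<in> range \<iota>"
      then obtain a where "x = \<iota> a"
        by blast
      moreover have "\<ominus>\<^bsub>L\<^esub> \<iota> a = \<iota> (- a)"
        by (rule L.minus_equality) (use \<iota>_S in \<open>auto simp: L_def \<iota>_add \<iota>_0\<close>)
      ultimately show "\<ominus>\<^bsub>L\<^esub> x \<in> range \<iota>"
        by blast
    next
      show "\<one>\<^bsub>L\<^esub> \<in> range \<iota>"
        using \<iota>_1 by (auto simp: L_def intro: range_eqI[of _ _ 1])
    qed (use \<iota>_S in \<open>auto simp: L_def \<iota>_add \<iota>_mult\<close>)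
    then show "subcring (range \<iota>) L"
      by (rule L.subcringI) (simp add: L_def mult.commute)
    show "Units (L\<lparr>carrier := range \<iota>\<rparr>) = range \<iota> - {\<zero>\<^bsub>L\<^esub>}"
    proof (intro equalityI subsetI)
      fix x assume "x \<in> range \<iota> - {\<zero>\<^bsub>L\<^esub>}"
      then obtain a where a: "x = \<iota> a" "a \<noteq> 0"
        using \<iota>_0 by (auto simp: L_def)
      then have "\<iota> (inverse a) * x = 1"
        by (simp add: \<iota>_mult \<iota>_1)
      with a(1) show "x \<in> Units (L\<lparr>carrier := range \<iota>\<rparr>)"
        by (auto simp: Units_def L_def mult.commute)
    qed (auto simp: Units_def L_def)
  qed
  \<comment> \<open>The quotient is therefore not the zero ring, and the field of constants maps
    onto a subfield of it.\<close>
  moreover have one_not_J: "1 \<notin> J"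
    using indep[of 0 1] by (auto simp: One_fract_def)
  ultimately have "subfield ((+>\<^bsub>L\<^esub>) J ` range \<iota>) (L Quot J)"
    using \<pi>.img_is_subfield(2)[of "range \<iota>"] zero_iff[of 1] \<iota>_S[of 1] \<iota>_1 \<pi>.hom_one
    by (auto simp: L_def)
  then have K: "subfield ?K (L Quot J)"
    by (simp add: image_image)
  define v where "v = J +>\<^bsub>L\<^esub> Fract (Var 4) 1"
  have v: "v \<in> carrier (L Quot J)"
    unfolding v_def using Fract_S[OF Var4] by (intro \<pi>.hom_closed) (simp add: L_def)
  have one_ne: "\<one>\<^bsub>L Quot J\<^esub> \<noteq> \<zero>\<^bsub>L Quot J\<^esub>"
    using zero_iff[of 1] \<iota>_S[of 1] \<iota>_1 one_not_J \<pi>.hom_one by (auto simp: L_def)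
  \<comment> \<open>Otherwise \<open>c_4 - a\<close> would lie in \<open>J\<close> for some constant
    \<open>a\<close>, against \<open>indep\<close>.\<close>
  have "v \<notin> Q.Span ?K [\<one>\<^bsub>L Quot J\<^esub>]"
  proof
    assume "v \<in> Q.Span ?K [\<one>\<^bsub>L Quot J\<^esub>]"
    then obtain a where a: "v = (J +>\<^bsub>L\<^esub> \<iota> a) \<otimes>\<^bsub>L Quot J\<^esub> \<one>\<^bsub>L Quot J\<^esub> \<oplus>\<^bsub>L Quot J\<^esub> \<zero>\<^bsub>L Quot J\<^esub>"
      by (auto simp: Q.line_extension_mem_iff)
    have closed: "J +>\<^bsub>L\<^esub> \<iota> b \<in> carrier (L Quot J)" for b
      using \<iota>_S by (intro \<pi>.hom_closed) (simp add: L_def)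
    have "v = J +>\<^bsub>L\<^esub> \<iota> a"
      using a closed by simp
    then have "v \<oplus>\<^bsub>L Quot J\<^esub> (J +>\<^bsub>L\<^esub> \<iota> (- a)) = J +>\<^bsub>L\<^esub> (\<iota> a + \<iota> (- a))"
      using \<pi>.hom_add[of "\<iota> a" "\<iota> (- a)"] \<iota>_S by (simp add: L_def)
    also have "\<dots> = \<zero>\<^bsub>L Quot J\<^esub>"
      using \<pi>.hom_zero by (simp add: \<iota>_add \<iota>_0 L_def)
    finally have "J +>\<^bsub>L\<^esub> (Fract (Var 4) 1 + \<iota> (- a)) = \<zero>\<^bsub>L Quot J\<^esub>"
      unfolding v_def using \<pi>.hom_add[of "Fract (Var 4) 1" "\<iota> (- a)"] \<iota>_S Fract_S[OF Var4]
      by (simp add: L_def)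
    then have "Fract (Var 4) 1 + \<iota> (- a) \<in> J"
      using zero_iff Fract_S[OF polys_in_add[OF Var4 Const_in_polys_in[of "- a"]]]
      by (simp add: \<iota>_def)
    then show False
      using indep[of 1 "- a"] by (simp add: \<iota>_def)
  qed
  then have "Q.independent ?K [v, \<one>\<^bsub>L Quot J\<^esub>]"
    using one_ne v by (intro Q.li_Cons Q.li_Nil) auto
  then have "2 \<le> n" if "Q.dimension n ?K (carrier (L Quot J))" for n
    using Q.independent_length_le_dimension[OF K that] v by force
  then have "2 \<le> Q.dim ?K (carrier (L Quot J))" if "Q.finite_dimension ?K (carrier (L Quot J))"
    using Q.finite_dimensionE[OF K that] by (simp add: over_def)
  \<comment> \<open>In the infinite-dimensional case the value \<infinity> exceeds 1 anyway.\<close>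
  then have "(1::enat) < (if Q.finite_dimension ?K (carrier (L Quot J))
      then enat (Q.dim ?K (carrier (L Quot J))) else \<infinity>)"
    by (auto simp: one_enat_def Suc_le_eq)
  then show ?thesis
    unfolding local_multiplicity_def Let_def L J_def[symmetric] \<iota>_def[symmetric] .
qed

section \<open>Complete symmetric polynomials and the Artin monomials\<close>

text \<open>The complete homogeneous symmetric polynomial \<open>h_r(c_1, ..., c_k)\<close>. The
  recursion separates monomials without the last variable from those divisible by it.\<close>

fun complete_sym :: "nat \<Rightarrow> nat \<Rightarrow> mpoly" where
  "complete_sym k 0 = 1"
| "complete_sym 0 (Suc r) = 0"
| "complete_sym (Suc k) (Suc r) = complete_sym k (Suc r) + Var (Suc k) * complete_sym (Suc k) r"

lemma polys_in_complete_sym: "k \<le> N \<Longrightarrow> complete_sym k r \<in> polys_in {1..N}"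
  by (induction k r rule: complete_sym.induct)
     (auto simp: polys_in_0 polys_in_1 intro!: polys_in_add polys_in_mult Var_in_polys_in)

text \<open>The generating series of the \<open>h_r\<close> in \<open>c_1, ..., c_k\<close> is
  inverse to the product of the \<open>1 - c_i T\<close> with \<open>i \<le> k\<close>, so only the
  factors with \<open>i > k\<close> survive.\<close>

lemma complete_sym_convolution:
  assumes "k \<le> N"
  shows "(\<Sum>j\<le>r. coeff (\<Prod>i=1..N. [:1, - Var i:]) j * complete_sym k (r - j)) =
    coeff (\<Prod>i=Suc k..N. [:1, - Var i:]) r"
  using assms
proof (induction k arbitrary: r)
  case 0
  have "complete_sym 0 (r - j) = (if j = r then 1 else 0)" if "j \<le> r" for j
    using that by (cases "r - j") auto
  then have "(\<Sum>j\<le>r. coeff (\<Prod>i=1..N. [:1, - Var i:]) j * complete_sym 0 (r - j)) =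
      (\<Sum>j\<le>r. if j = r then coeff (\<Prod>i=1..N. [:1, - Var i:]) j else 0)"
    by (intro sum.cong) auto
  then show ?case
    by simp
next
  case (Suc k)
  let ?E = "\<lambda>k. \<Prod>i=k..N. [:1, - Var i:]"
  have split: "?E (Suc k) = [:1, - Var (Suc k):] * ?E (Suc (Suc k))"
    using Suc.prems by (simp add: prod.atLeast_Suc_atMost)
  have IH: "(\<Sum>j\<le>r. coeff (?E 1) j * complete_sym k (r - j)) = coeff (?E (Suc k)) r" for r
    using Suc by simp
  \<comment> \<open>An inner induction on the degree: the recursion reduces degree
    \<open>Suc r\<close> to fewer variables and to degree \<open>r\<close>.\<close>
  show ?case
  proof (induction r)
    case 0
    show ?case
      using IH[of 0] split by simp
  next
    case (Suc r)
    have step: "complete_sym (Suc k) (Suc r - j) =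
        complete_sym k (Suc r - j) + Var (Suc k) * complete_sym (Suc k) (r - j)" if "j \<le> r" for j
      using that by (simp add: Suc_diff_le)
    have "(\<Sum>j\<le>Suc r. coeff (?E 1) j * complete_sym (Suc k) (Suc r - j)) =
        (\<Sum>j\<le>Suc r. coeff (?E 1) j * complete_sym k (Suc r - j)) +
        Var (Suc k) * (\<Sum>j\<le>r. coeff (?E 1) j * complete_sym (Suc k) (r - j))"
      by (simp add: step distrib_left sum.distrib sum_distrib_left mult_ac)
    also have "\<dots> = coeff (?E (Suc k)) (Suc r) + Var (Suc k) * coeff (?E (Suc (Suc k))) r"
      by (simp only: IH Suc.IH)
    also have "\<dots> = coeff (?E (Suc (Suc k))) (Suc r)"
      by (simp add: split)
    finally show ?case .
  qed
qed

text \<open>Modulo the ideal, \<open>(-1)\<^sup>j s\<^sub>j = c\<^sub>j\<close>; substituting this into the identity above with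
  \<open>r = N - k + 1\<close>, where its right-hand side vanishes for degree reasons, gives the relation.\<close>

lemma complete_sym_relation:
  assumes "1 \<le> k" "k \<le> N"
  defines "r \<equiv> Suc N - k"
  shows "complete_sym k r + (\<Sum>j=1..r. Var j * complete_sym k (r - j)) \<in> ulam_ideal N"
proof -
  let ?E = "\<Prod>i=1..N. [:1, - Var i:]"
  have coeff_E: "coeff ?E j = (-1) ^ j * alpha N j + Var j" for j
    by (simp add: coeff_prod_one_minus alpha_def elem_sym_def right_diff_distrib
        flip: mult.assoc power_mult_distrib)
  have coeff_0: "coeff ?E 0 = 1"
    by (simp add: poly_prod flip: poly_0_coeff_0)
  have "degree (\<Prod>i=Suc k..N. [:1, - Var i:]) \<le> (\<Sum>i=Suc k..N. degree [:1, - Var i:])"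
    using degree_prod_sum_le[of "{Suc k..N}" "\<lambda>i. [:1, - Var i:]"] by (simp only: o_def finite_atLeastAtMost)
  also have "\<dots> \<le> (\<Sum>i=Suc k..N. 1)"
    by (rule sum_mono) simp
  also have "\<dots> < r"
    using assms by simp
  finally have "coeff (\<Prod>i=Suc k..N. [:1, - Var i:]) r = 0"
    by (rule coeff_eq_0)
  then have "(\<Sum>j\<le>r. coeff ?E j * complete_sym k (r - j)) = 0"
    using complete_sym_convolution[OF assms(2), of r] by simp
  then have "complete_sym k r + (\<Sum>j=1..r. coeff ?E j * complete_sym k (r - j)) = 0"
  proof -
    have "{..r} = insert 0 {1..r}"
      by auto
    moreover have "0 \<notin> {1..r}"
      by simp
    ultimately show ?thesis
      using \<open>(\<Sum>j\<le>r. coeff ?E j * complete_sym k (r - j)) = 0\<close> by (simp add: coeff_0 del: One_nat_def)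
  qed
  moreover have "(\<Sum>j=1..r. Var j * complete_sym k (r - j)) =
      (\<Sum>j=1..r. coeff ?E j * complete_sym k (r - j)) +
      (\<Sum>j=1..r. (- ((-1) ^ j * complete_sym k (r - j))) * alpha N j)"
    unfolding sum.distrib[symmetric] coeff_E by (intro sum.cong refl) (simp add: algebra_simps)
  ultimately have "complete_sym k r + (\<Sum>j=1..r. Var j * complete_sym k (r - j)) =
      (\<Sum>j=1..r. (- ((-1) ^ j * complete_sym k (r - j))) * alpha N j)"
    by (simp flip: add.assoc)
  also have "\<dots> \<in> ulam_ideal N"
  proof (intro ulam_ideal_sum ulam_ideal_rules(4) alpha_in_ulam_ideal)
    show "- ((-1) ^ j * complete_sym k (r - j)) \<in> polys_in {1..N}" for j
      using assms by (intro polys_in_uminus polys_in_mult polys_in_power polys_in_1 polys_in_complete_sym)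
  qed (use assms in auto)
  finally show ?thesis .
qed

text \<open>With \<open>c\<^sub>i\<close> of weight \<open>i + 1\<close>, the power \<open>c\<^sub>k\<^sup>r\<close> is the unique heaviest monomial of the relation
  above: passing to smaller indices and passing to smaller degree both lower the weight. Only for
  \<open>k = 1\<close> does it occur twice, with coefficient \<open>2\<close> in total.\<close>

definition weight :: "monom \<Rightarrow> nat" where
  "weight m = (\<Sum>i\<in>Poly_Mapping.keys m. Poly_Mapping.lookup m i * Suc i)"

lemma weight_superset:
  assumes "finite S" "Poly_Mapping.keys m \<subseteq> S"
  shows "weight m = (\<Sum>i\<in>S. Poly_Mapping.lookup m i * Suc i)"
  unfolding weight_def
  by (rule sum.mono_neutral_left) (use assms in \<open>auto simp: in_keys_iff\<close>)

lemma weight_add: "weight (m + n) = weight m + weight n"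
proof -
  let ?S = "Poly_Mapping.keys m \<union> Poly_Mapping.keys n"
  show ?thesis
    using Poly_Mapping.keys_add[of m n]
    by (simp add: weight_superset[of ?S] lookup_add distrib_right sum.distrib del: mult_Suc_right)
qed

lemma weight_single: "weight (Poly_Mapping.single i k) = k * Suc i"
  by (simp add: weight_superset[of "{i}"])

text \<open>The bound is strict, so that only 0 lies at level 0, where the induction on the weight
  starts.\<close>

definition weight_below :: "nat \<Rightarrow> nat \<Rightarrow> mpoly set" where
  "weight_below N w = {p \<in> polys_in {1..N}. \<forall>m\<in>Poly_Mapping.keys p. weight m < w}"

lemma weight_below_mono: "p \<in> weight_below N v \<Longrightarrow> v \<le> w \<Longrightarrow> p \<in> weight_below N w"
  by (auto simp: weight_below_def)

lemma weight_below_0: "0 \<in> weight_below N w"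
  by (simp add: weight_below_def polys_in_0)

lemma weight_below_add:
  "p \<in> weight_below N w \<Longrightarrow> q \<in> weight_below N w \<Longrightarrow> p + q \<in> weight_below N w"
  using Poly_Mapping.keys_add[of p q] by (auto simp: weight_below_def polys_in_add)

lemma weight_below_sum:
  "(\<And>x. x \<in> A \<Longrightarrow> f x \<in> weight_below N w) \<Longrightarrow> sum f A \<in> weight_below N w"
  by (induction A rule: infinite_finite_induct) (auto simp: weight_below_0 weight_below_add)

text \<open>\<open>Suc v\<close> stands for weight at most \<open>v\<close>: one weak and one strict
  bound add up to a strict one.\<close>

lemma weight_below_mult:
  assumes "p \<in> weight_below N (Suc v)" "q \<in> weight_below N w"
  shows "p * q \<in> weight_below N (v + w)"
proof -
  have "weight k < v + w" if "k \<in> Poly_Mapping.keys (p * q)" for k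
  proof -
    from that obtain m n where "k = m + n" "m \<in> Poly_Mapping.keys p" "n \<in> Poly_Mapping.keys q"
      using Poly_Mapping.keys_mult[of p q] by blast
    with assms show ?thesis
      by (auto simp: weight_below_def weight_add less_Suc_eq_le intro: add_le_less_mono)
  qed
  with assms show ?thesis
    by (auto simp: weight_below_def polys_in_mult)
qed

lemma weight_below_single:
  "weight m < w \<Longrightarrow> Poly_Mapping.keys m \<subseteq> {1..N} \<Longrightarrow> Poly_Mapping.single m a \<in> weight_below N w"
  by (auto simp: weight_below_def polys_in_single)

lemma weight_below_Var: "i \<in> {1..N} \<Longrightarrow> Var i \<in> weight_below N (Suc (Suc i))"
  unfolding Var_def by (rule weight_below_single) (auto simp: weight_single)

lemma Var_power: "Var i ^ n = Poly_Mapping.single (Poly_Mapping.single i n) 1"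
  by (induction n) (simp_all add: Var_def mult_single flip: single_add)

lemma complete_sym_weight: "k \<le> N \<Longrightarrow> complete_sym k r \<in> weight_below N (Suc (r * Suc k))"
proof (induction k r rule: complete_sym.induct)
  case (1 k)
  show ?case
    using weight_below_single[of 0 1 N 1] by (simp add: weight_def)
next
  case (2 r)
  show ?case
    by (simp add: weight_below_0)
next
  case (3 k r)
  have "complete_sym k (Suc r) \<in> weight_below N (Suc (Suc r * Suc (Suc k)))"
    by (rule weight_below_mono[OF 3(1)]) (use 3(3) in auto)
  moreover have "Var (Suc k) * complete_sym (Suc k) r
      \<in> weight_below N (Suc (Suc r * Suc (Suc k)))"
    by (rule weight_below_mono[OF weight_below_mult[OF weight_below_Var 3(2)]]) (use 3(3) in auto)
  ultimately show ?case
    unfolding complete_sym.simps by (rule weight_below_add)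
qed

text \<open>Every monomial of \<open>h_r\<close> other than the pure power contains a variable
  lighter than the last one.\<close>

lemma complete_sym_leading:
  "Suc k \<le> N \<Longrightarrow> complete_sym (Suc k) r - Var (Suc k) ^ r \<in> weight_below N (r * Suc (Suc k))"
proof (induction r)
  case 0
  show ?case
    by (simp add: weight_below_0)
next
  case (Suc r)
  have "complete_sym k (Suc r) \<in> weight_below N (Suc r * Suc (Suc k))"
    by (rule weight_below_mono[OF complete_sym_weight]) (use Suc.prems in auto)
  moreover have "Var (Suc k) * (complete_sym (Suc k) r - Var (Suc k) ^ r)
      \<in> weight_below N (Suc r * Suc (Suc k))"
    by (rule weight_below_mono[OF weight_below_mult[OF weight_below_Var Suc.IH]]) (use Suc.prems in auto)
  ultimately have "complete_sym k (Suc r) + Var (Suc k) * (complete_sym (Suc k) r - Var (Suc k) ^ r)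
      \<in> weight_below N (Suc r * Suc (Suc k))"
    by (rule weight_below_add)
  then show ?case
    by (simp add: right_diff_distrib add_diff_eq del: mult_Suc_right)
qed

text \<open>A rewriting rule: modulo the ideal, a high enough power of \<open>c_k\<close> is a
  combination of lighter monomials.\<close>

lemma leading_power_relation:
  assumes "1 \<le> k" "k \<le> N"
  defines "r \<equiv> Suc N - k"
  obtains c s where "c \<noteq> 0" "s \<in> weight_below N (r * Suc k)"
    "Const c * Var k ^ r + s \<in> ulam_ideal N"
proof -
  obtain k' where k: "k = Suc k'"
    using assms by (cases k) auto
  have r: "1 \<le> r" "r \<le> N"
    using assms by auto
  define s0 where "s0 = complete_sym k r - Var k ^ r"
  have s0: "s0 \<in> weight_below N (r * Suc k)"
    using complete_sym_leading[of k' N r] assms k by (simp add: s0_def)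
  \<comment> \<open>The weight is at most \<open>(j + 1) + (r - j) * (k + 1)\<close>, which falls
    short of \<open>r * (k + 1)\<close> by \<open>j * k - 1\<close>; only \<open>j = k = 1\<close>
    gives no gap.\<close>
  have term_bound: "Var j * complete_sym k (r - j) \<in> weight_below N (r * Suc k)"
    if j: "j \<in> {1..r}" "2 \<le> j * k" for j
  proof (rule weight_below_mono[OF weight_below_mult])
    show "Var j \<in> weight_below N (Suc (Suc j))"
      by (rule weight_below_Var) (use j r in auto)
    show "complete_sym k (r - j) \<in> weight_below N (Suc ((r - j) * Suc k))"
      by (rule complete_sym_weight[OF assms(2)])
    have "r * Suc k = j * Suc k + (r - j) * Suc k"
      using j by (metis add_mult_distrib atLeastAtMost_iff le_add_diff_inverse)
    with j show "Suc j + Suc ((r - j) * Suc k) \<le> r * Suc k"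
      by simp
  qed
  let ?R = "complete_sym k r + (\<Sum>j=1..r. Var j * complete_sym k (r - j))"
  have R: "?R \<in> ulam_ideal N"
    using complete_sym_relation[OF assms(1,2)] by (simp add: r_def)
  show thesis
  proof (cases "k = 1")
    case False
    have s: "s0 + (\<Sum>j=1..r. Var j * complete_sym k (r - j)) \<in> weight_below N (r * Suc k)"
    proof (intro weight_below_add[OF s0] weight_below_sum term_bound)
      fix j assume "j \<in> {1..r}"
      then have "1 * 2 \<le> j * k"
        using False assms(1) by (intro mult_le_mono) auto
      then show "2 \<le> j * k"
        by simp
    qed
    have "Const 1 * Var k ^ r + (s0 + (\<Sum>j=1..r. Var j * complete_sym k (r - j))) = ?R"
      by (simp add: s0_def)
    with R show thesis
      by (intro that[OF one_neq_zero s]) (simp only:)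
  next
    case True
    \<comment> \<open>For \<open>k = 1\<close> the summand \<open>j = 1\<close> is a second copy of
      the leading power plus the lighter rest \<open>s1\<close>.\<close>
    define s1 where "s1 = Var 1 * (complete_sym 1 (r - 1) - Var 1 ^ (r - 1))"
    define t where "t = (\<Sum>j=2..r. Var j * complete_sym k (r - j))"
    have "s1 \<in> weight_below N (2 + (r - 1) * 2)"
      unfolding s1_def using r complete_sym_leading[of 0 N "r - 1"]
      by (intro weight_below_mult) (auto simp: numeral_2_eq_2 intro!: weight_below_Var)
    then have s1: "s1 \<in> weight_below N (r * Suc k)"
      using r True by (auto elim!: weight_below_mono)
    have t: "t \<in> weight_below N (r * Suc k)"
      unfolding t_def using True by (intro weight_below_sum term_bound) auto
    have "Var 1 * Var 1 ^ (r - 1) = Var 1 ^ r"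
      using r by (simp flip: power_Suc)
    then have s1': "Var 1 * complete_sym 1 (r - 1) = Var 1 ^ r + s1"
      by (simp add: s1_def right_diff_distrib)
    have "?R = complete_sym k r + (Var 1 * complete_sym k (r - 1) + t)"
      unfolding t_def using r by (simp add: sum.atLeast_Suc_atMost numeral_2_eq_2)
    also have "\<dots> = Const 2 * Var k ^ r + (s0 + (s1 + t))"
      using True s1' Const_add[of 1 1] by (simp add: s0_def algebra_simps)
    finally show thesis
      using that[of 2 "s0 + (s1 + t)"] R s0 s1 t by (auto intro: weight_below_add)
  qed
qed

text \<open>The monomials divisible by none of the leading powers \<open>c_i^(N - i + 1)\<close>,
  hence those at which rewriting stops.\<close>

definition artin_monoms :: "nat \<Rightarrow> monom set" where
  "artin_monoms N = {m. Poly_Mapping.keys m \<subseteq> {1..N} \<and> (\<forall>i\<in>{1..N}. Poly_Mapping.lookup m i \<le> N - i)}"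

text \<open>The exponent at index \<open>i\<close> has \<open>N - i + 1\<close> possible values, and
  these numbers multiply to \<open>N!\<close>.\<close>

lemma artin_monoms_card: "finite (artin_monoms N) \<and> card (artin_monoms N) \<le> fact N"
proof -
  let ?F = "PiE {1..N} (\<lambda>i. {..N - i})"
  have inj: "inj_on (\<lambda>m. restrict (Poly_Mapping.lookup m) {1..N}) (artin_monoms N)"
  proof (rule inj_onI, rule poly_mapping_eqI)
    fix m n i
    assume mn: "m \<in> artin_monoms N" "n \<in> artin_monoms N"
      "restrict (Poly_Mapping.lookup m) {1..N} = restrict (Poly_Mapping.lookup n) {1..N}"
    show "Poly_Mapping.lookup m i = Poly_Mapping.lookup n i"
    proof (cases "i \<in> {1..N}")
      case True
      then show ?thesis
        using fun_cong[OF mn(3), of i] by simp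
    next
      case False
      then have "i \<notin> Poly_Mapping.keys m" "i \<notin> Poly_Mapping.keys n"
        using mn by (auto simp: artin_monoms_def)
      then show ?thesis
        by (simp add: in_keys_iff)
    qed
  qed
  have img: "(\<lambda>m. restrict (Poly_Mapping.lookup m) {1..N}) ` artin_monoms N \<subseteq> ?F"
    by (auto simp: artin_monoms_def)
  have fin: "finite ?F"
    by (simp add: finite_PiE)
  have "card ?F = (\<Prod>i=1..N. Suc (N - i))"
    by (simp add: card_PiE)
  also have "\<dots> = (\<Prod>i=1..N. N + 1 - i)"
    by (intro prod.cong) auto
  also have "\<dots> = fact N"
    by (subst prod.atLeastAtMost_rev[symmetric]) (simp add: fact_prod)
  finally have "card ?F = fact N" .
  with inj img fin show ?thesis
    using finite_subset finite_imageD card_inj_on_le by metis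
qed

section \<open>Reduction modulo the ideal and the dimension bound \<open>N!\<close>\<close>

definition reducible_mod :: "nat \<Rightarrow> mpoly \<Rightarrow> bool" where
  "reducible_mod N p \<longleftrightarrow> (\<exists>a. Poly_Mapping.keys a \<subseteq> artin_monoms N \<and> p - a \<in> ulam_ideal N)"

lemma reducible_mod_ideal: "p \<in> ulam_ideal N \<Longrightarrow> reducible_mod N p"
  unfolding reducible_mod_def by (intro exI[of _ 0]) simp

lemma reducible_mod_add:
  assumes "reducible_mod N p" "reducible_mod N q"
  shows "reducible_mod N (p + q)"
proof -
  from assms obtain a b where ab: "Poly_Mapping.keys a \<subseteq> artin_monoms N" "p - a \<in> ulam_ideal N"
    "Poly_Mapping.keys b \<subseteq> artin_monoms N" "q - b \<in> ulam_ideal N"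
    unfolding reducible_mod_def by blast
  then have "(p - a) + (q - b) \<in> ulam_ideal N"
    by (intro ulam_ideal_rules(3))
  then show ?thesis
    unfolding reducible_mod_def using ab Poly_Mapping.keys_add[of a b]
    by (intro exI[of _ "a + b"]) (auto simp: algebra_simps)
qed

lemma reducible_mod_sum:
  "(\<And>x. x \<in> A \<Longrightarrow> reducible_mod N (f x)) \<Longrightarrow> reducible_mod N (sum f A)"
  by (induction A rule: infinite_finite_induct)
     (auto simp: reducible_mod_add intro!: reducible_mod_ideal ulam_ideal_rules(2))

text \<open>Rewriting terminates because each application of \<open>leading_power_relation\<close>
  lowers the weight.\<close>

lemma reducible_mod_weight_below: "p \<in> weight_below N w \<Longrightarrow> reducible_mod N p"
proof (induction w arbitrary: p)
  case 0
  then have "p = 0"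
    by (simp add: weight_below_def)
  then show ?case
    by (simp add: reducible_mod_ideal ulam_ideal_rules(2))
next
  case (Suc w)
  have "reducible_mod N (Poly_Mapping.single m a)"
    if m: "Poly_Mapping.keys m \<subseteq> {1..N}" "weight m \<le> w" for m a
  proof (cases "m \<in> artin_monoms N")
    case True
    then show ?thesis
      unfolding reducible_mod_def
      by (intro exI[of _ "Poly_Mapping.single m a"]) (auto simp: ulam_ideal_rules(2))
  next
    case False
    then obtain k where k: "k \<in> {1..N}" "N - k < Poly_Mapping.lookup m k"
      using m by (auto simp: artin_monoms_def not_le)
    define r where "r = Suc N - k"
    obtain c s where cs: "c \<noteq> 0" "s \<in> weight_below N (r * Suc k)"
      "Const c * Var k ^ r + s \<in> ulam_ideal N"
      using k by (auto simp: r_def intro: leading_power_relation)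
    define m' where "m' = m - Poly_Mapping.single k r"
    have mm': "m = m' + Poly_Mapping.single k r"
      using k by (intro poly_mapping_eqI) (auto simp: m'_def r_def lookup_add lookup_minus lookup_single when_def)
    have keys: "Poly_Mapping.keys m' \<subseteq> {1..N}"
      using m(1) by (auto simp: m'_def in_keys_iff lookup_minus)
    have wt: "weight m = weight m' + r * Suc k"
      by (simp add: mm' weight_add weight_single)
    \<comment> \<open>Dividing by \<open>c\<close> makes \<open>X\<close> times the leading term
      exactly the given monomial; what remains is \<open>- (X * s)\<close>, which is
      lighter.\<close>
    define X where "X = Poly_Mapping.single m' (a / c)"
    have "X * (Const c * Var k ^ r + s) \<in> ulam_ideal N"
      unfolding X_def using cs keys by (intro ulam_ideal_rules(4) polys_in_single)
    moreover have "X * (Const c * Var k ^ r + s) = Poly_Mapping.single m a + X * s"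
      using cs(1) by (simp add: X_def Const_def Var_power mult_single distrib_left mm')
    moreover have "Poly_Mapping.single m' (- a / c) * s \<in> weight_below N (weight m' + r * Suc k)"
      using cs keys by (intro weight_below_mult weight_below_single) auto
    then have "reducible_mod N (Poly_Mapping.single m' (- a / c) * s)"
      using m wt by (intro Suc.IH) (auto elim!: weight_below_mono)
    then have "reducible_mod N (- (X * s))"
      by (simp add: X_def single_uminus)
    ultimately show ?thesis
      using reducible_mod_add[OF reducible_mod_ideal] by (metis add_diff_cancel_right' diff_conv_add_uminus)
  qed
  then show ?case
    using Suc.prems unfolding weight_below_def polys_in_def
    by (subst mpoly_eq_sum_single[of p]) (auto intro!: reducible_mod_sum simp: less_Suc_eq_le)
qed

lemma reducible_mod_polys_in:
  assumes "p \<in> polys_in {1..N}"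
  shows "reducible_mod N p"
proof (rule reducible_mod_weight_below)
  show "p \<in> weight_below N (Suc (Max (insert 0 (weight ` Poly_Mapping.keys p))))"
    using assms by (auto simp: weight_below_def less_Suc_eq_le)
qed

text \<open>More vectors than coordinates: Gaussian elimination removes one coordinate and one pivot
  vector at a time.\<close>

lemma linear_dependence:
  fixes v :: "'j \<Rightarrow> 'a \<Rightarrow> 'f::field"
  assumes "finite A" "finite J" "card A < card J"
  obtains b where "\<exists>j\<in>J. b j \<noteq> 0" "\<And>x. x \<in> A \<Longrightarrow> (\<Sum>j\<in>J. b j * v j x) = 0"
proof -
  have "\<exists>b. (\<exists>j\<in>J. b j \<noteq> 0) \<and> (\<forall>x\<in>A. (\<Sum>j\<in>J. b j * v j x) = 0)"
    using assms
  proof (induction A arbitrary: J v)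
    case empty
    then have "J \<noteq> {}"
      by auto
    then show ?case
      by (intro exI[of _ "\<lambda>_. 1"]) auto
  next
    case (insert x A)
    show ?case
    proof (cases "\<forall>j\<in>J. v j x = 0")
      case True
      have "card A < card J"
        using insert by simp
      with insert.IH[OF insert.prems(1)] True show ?thesis
        by fastforce
    next
      case False
      then obtain i where i: "i \<in> J" "v i x \<noteq> 0"
        by blast
      let ?J = "J - {i}"
      \<comment> \<open>Subtracting a multiple of the pivot vector \<open>v i\<close> clears
        coordinate \<open>x\<close>.\<close>
      define u where "u j y = v j y - v j x / v i x * v i y" for j y
      have "card A < card ?J"
        using insert i by simp
      with insert.IH[of ?J u] insert.prems obtain b where b: "\<exists>j\<in>?J. b j \<noteq> 0"
        "\<forall>y\<in>A. (\<Sum>j\<in>?J. b j * u j y) = 0"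
        by auto
      \<comment> \<open>The pivot coefficient collects the subtracted multiples, so that
        \<open>b'\<close> on \<open>v\<close> gives the same combination as \<open>b\<close> on
        \<open>u\<close>.\<close>
      define b' where "b' = b(i := - (\<Sum>j\<in>?J. b j * v j x / v i x))"
      have "(\<Sum>j\<in>J. b' j * v j y) = (\<Sum>j\<in>?J. b j * u j y)" for y
      proof -
        have "(\<Sum>j\<in>J. b' j * v j y) = b' i * v i y + (\<Sum>j\<in>?J. b' j * v j y)"
          using i insert.prems by (simp add: sum.remove)
        also have "(\<Sum>j\<in>?J. b' j * v j y) = (\<Sum>j\<in>?J. b j * v j y)"
          by (intro sum.cong) (auto simp: b'_def)
        finally show ?thesis
          by (simp add: b'_def u_def right_diff_distrib sum_subtractf sum_distrib_right mult.assoc)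
      qed
      moreover have "u j x = 0" for j
        using i by (simp add: u_def)
      moreover have "\<exists>j\<in>J. b' j \<noteq> 0"
        using b(1) by (auto simp: b'_def)
      ultimately show ?thesis
        using b(2) by (intro exI[of _ b']) auto
    qed
  qed
  then show thesis
    using that by blast
qed

text \<open>In effect the quotient by the ideal has dimension at most \<open>N!\<close>: a
  dependence among the reduced forms lifts to the polynomials modulo the ideal.\<close>

lemma ulam_ideal_dependence:
  assumes "finite J" "card J > fact N" "\<And>j. j \<in> J \<Longrightarrow> f j \<in> polys_in {1..N}"
  obtains b where "\<exists>j\<in>J. b j \<noteq> 0" "(\<Sum>j\<in>J. Const (b j) * f j) \<in> ulam_ideal N"
proof -
  have "\<forall>j\<in>J. \<exists>a. Poly_Mapping.keys a \<subseteq> artin_monoms N \<and> f j - a \<in> ulam_ideal N"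
    using assms(3) reducible_mod_polys_in unfolding reducible_mod_def by blast
  then obtain a where a: "\<And>j. j \<in> J \<Longrightarrow> Poly_Mapping.keys (a j) \<subseteq> artin_monoms N"
    "\<And>j. j \<in> J \<Longrightarrow> f j - a j \<in> ulam_ideal N"
    by metis
  obtain b where b: "\<exists>j\<in>J. b j \<noteq> 0"
    "\<And>m. m \<in> artin_monoms N \<Longrightarrow> (\<Sum>j\<in>J. b j * Poly_Mapping.lookup (a j) m) = 0"
    by (rule linear_dependence[of "artin_monoms N" J "\<lambda>j. Poly_Mapping.lookup (a j)"])
      (use artin_monoms_card[of N] assms(1,2) in auto)
  have "(\<Sum>j\<in>J. Const (b j) * a j) = 0"
  proof (rule poly_mapping_eqI)
    fix m
    have "(\<Sum>j\<in>J. b j * Poly_Mapping.lookup (a j) m) = 0"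
    proof (cases "m \<in> artin_monoms N")
      case False
      then have "Poly_Mapping.lookup (a j) m = 0" if "j \<in> J" for j
        using a(1)[OF that] by (auto simp: in_keys_iff)
      then show ?thesis
        by simp
    qed (rule b)
    then show "Poly_Mapping.lookup (\<Sum>j\<in>J. Const (b j) * a j) m = Poly_Mapping.lookup 0 m"
      by (simp add: lookup_sum lookup_Const_mult)
  qed
  then have "(\<Sum>j\<in>J. Const (b j) * f j) = (\<Sum>j\<in>J. Const (b j) * (f j - a j))"
    by (simp add: right_diff_distrib sum_subtractf)
  also have "\<dots> \<in> ulam_ideal N"
    by (intro ulam_ideal_sum ulam_ideal_rules(4) Const_in_polys_in a(2))
  finally show thesis
    using that b(1) by blast
qed

section \<open>Counting solutions\<close>

lemma separating_poly:
  assumes "P \<in> ulam_solutions N" "Q \<in> ulam_solutions N" "P \<noteq> Q"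
  obtains f where "f \<in> polys_in {1..N}" "eval_mpoly P f = 1" "eval_mpoly Q f = 0"
proof -
  have "P \<in> {1..N} \<rightarrow>\<^sub>E UNIV" "Q \<in> {1..N} \<rightarrow>\<^sub>E UNIV"
    using assms by (auto simp: ulam_solutions_def)
  with assms(3) obtain i where i: "i \<in> {1..N}" "P i \<noteq> Q i"
    by (metis PiE_ext)
  let ?f = "Const (1 / (P i - Q i)) * (Var i - Const (Q i))"
  have "?f \<in> polys_in {1..N}"
    using i by (intro polys_in_mult polys_in_diff Const_in_polys_in Var_in_polys_in)
  moreover have "eval_mpoly P ?f = 1" "eval_mpoly Q ?f = 0"
    using i by (auto simp: eval_mpoly_mult eval_diff eval_Const eval_Var)
  ultimately show thesis
    using that by blast
qed

text \<open>Lagrange interpolation, as a product of polynomials separating \<open>P\<close> from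
  each other point.\<close>

lemma interpolating_poly:
  assumes "finite T" "T \<subseteq> ulam_solutions N" "P \<in> T"
  obtains f where "f \<in> polys_in {1..N}" "eval_mpoly P f = 1"
    "\<And>Q. Q \<in> T \<Longrightarrow> Q \<noteq> P \<Longrightarrow> eval_mpoly Q f = 0"
proof -
  have "\<exists>f. f \<in> polys_in {1..N} \<and> eval_mpoly P f = 1 \<and> eval_mpoly Q f = 0" if "Q \<in> T - {P}" for Q
    using separating_poly[of P N Q] assms that by (metis Diff_iff insertI1 subsetD)
  then obtain f where f: "\<And>Q. Q \<in> T - {P} \<Longrightarrow> f Q \<in> polys_in {1..N}"
    "\<And>Q. Q \<in> T - {P} \<Longrightarrow> eval_mpoly P (f Q) = 1" "\<And>Q. Q \<in> T - {P} \<Longrightarrow> eval_mpoly Q (f Q) = 0"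
    by metis
  show thesis
  proof (rule that[of "\<Prod>Q\<in>T - {P}. f Q"])
    show "eval_mpoly Q (\<Prod>Q\<in>T - {P}. f Q) = 0" if "Q \<in> T" "Q \<noteq> P" for Q
      unfolding eval_prod using assms(1) that f(3) by (intro prod_zero) blast+
    show "(\<Prod>Q\<in>T - {P}. f Q) \<in> polys_in {1..N}"
      by (intro polys_in_prod f(1))
  qed (simp add: eval_prod f)
qed

text \<open>With \<open>N!\<close> points, their interpolating polynomials and one extra polynomial
  testing the derivative would be dependent modulo the ideal. Working with finite sets
  \<open>T\<close> avoids presupposing that there are finitely many solutions.\<close>

lemma card_solutions_through_tangent_point:
  assumes N: "N \<ge> 4" and T: "finite T" "T \<subseteq> ulam_solutions N" "tangent_point N \<in> T"
  shows "card T < fact N"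
proof (rule ccontr)
  assume ge: "\<not> card T < fact N"
  let ?P = "tangent_point N"
  have "\<exists>f. f \<in> polys_in {1..N} \<and> eval_mpoly P f = 1 \<and> (\<forall>Q\<in>T - {P}. eval_mpoly Q f = 0)"
    if "P \<in> T" for P
    using interpolating_poly[OF T(1,2) that] by (metis Diff_iff insertI1)
  then obtain f where f: "\<And>P. P \<in> T \<Longrightarrow> f P \<in> polys_in {1..N}"
    "\<And>P. P \<in> T \<Longrightarrow> eval_mpoly P (f P) = 1"
    "\<And>P Q. P \<in> T \<Longrightarrow> Q \<in> T \<Longrightarrow> Q \<noteq> P \<Longrightarrow> eval_mpoly Q (f P) = 0"
    by (metis Diff_iff singletonD)
  \<comment> \<open>The extra polynomial, at index \<open>None\<close>, vanishes on all of
    \<open>T\<close> but has nonzero derivative along the curve.\<close>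
  define g where "g = case_option (Var 4 * f ?P) f"
  define J where "J = insert None (Some ` T)"
  have "card J = Suc (card T)"
    unfolding J_def using T(1) by (simp add: card_image)
  then have J: "finite J" "card J > fact N"
    using ge T(1) by (auto simp: J_def)
  have Var4: "Var 4 \<in> polys_in {1..N}"
    using N by (intro Var_in_polys_in) auto
  then have "g j \<in> polys_in {1..N}" if "j \<in> J" for j
    using that f(1) T(3) by (auto simp: g_def J_def intro!: polys_in_mult)
  with J obtain b where b: "\<exists>j\<in>J. b j \<noteq> 0" "(\<Sum>j\<in>J. Const (b j) * g j) \<in> ulam_ideal N"
    by (rule ulam_ideal_dependence)
  have sum_J: "(\<Sum>j\<in>J. Const (b j) * g j) =
      Const (b None) * (Var 4 * f ?P) + (\<Sum>P\<in>T. Const (b (Some P)) * f P)"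
    unfolding J_def using T(1) by (simp add: sum.reindex g_def)
  have b_Some: "b (Some Q) = 0" if Q: "Q \<in> T" for Q
  proof -
    have "0 = eval_mpoly Q (\<Sum>j\<in>J. Const (b j) * g j)"
      using eval_ulam_ideal[OF _ b(2)] Q T(2) by auto
    also have "\<dots> = b None * (Q 4 * eval_mpoly Q (f ?P)) + (\<Sum>P\<in>T. b (Some P) * eval_mpoly Q (f P))"
      by (simp add: sum_J eval_mpoly_add eval_mpoly_mult eval_mpoly_sum eval_Const eval_Var)
    \<comment> \<open>At the tangent point \<open>c_4\<close> is 0; at every other point of
      \<open>T\<close> the interpolating factor is.\<close>
    also have "Q 4 * eval_mpoly Q (f ?P) = 0"
      using f(3)[OF T(3) Q] N by (cases "Q = ?P") (auto simp: tangent_point_def tangent_curve_def)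
    also have "(\<Sum>P\<in>T. b (Some P) * eval_mpoly Q (f P)) = (\<Sum>P\<in>T. if P = Q then b (Some Q) else 0)"
      using Q f by (intro sum.cong) auto
    also have "\<dots> = b (Some Q)"
      using Q T(1) by simp
    finally show ?thesis
      by simp
  qed
  \<comment> \<open>Only the derivative test is left in the relation, and its factor
    \<open>f ?P\<close> has value 1 at the point.\<close>
  then have "flat (Const (b None) * Var 4 * f ?P)"
    using flat_ulam_ideal[OF N b(2)] by (simp add: sum_J mult.assoc)
  then have "flat (Const (b None) * Var 4)"
    by (rule flat_multD) (use f(1,2)[OF T(3)] in \<open>simp add: eval_tangent_point\<close>)
  then have "b None = 0"
    using flat_tangent[of "Const (b None) * Var 4" 0 "b None"]
    by (simp add: eval_mpoly_mult eval_Const eval_Var tangent_curve_def)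
  with b(1) b_Some show False
    by (auto simp: J_def)
qed

text \<open>Infinitely many solutions would allow \<open>N!\<close> of them to be joined to the
  tangent point, against the previous bound.\<close>

lemma ulam_solutions_card:
  assumes N: "N \<ge> 4"
  shows "finite (ulam_solutions N) \<and> card (ulam_solutions N) < fact N"
proof -
  let ?S = "ulam_solutions N"
  have "finite ?S"
  proof (rule ccontr)
    assume inf: "infinite ?S"
    then have "infinite (?S - {tangent_point N})"
      by simp
    then obtain T where T: "T \<subseteq> ?S - {tangent_point N}" "finite T" "card T = fact N"
      using infinite_arbitrarily_large by blast
    have "card (insert (tangent_point N) T) < fact N"
      using T tangent_point_solution[OF N] by (intro card_solutions_through_tangent_point N) auto
    moreover have "card T \<le> card (insert (tangent_point N) T)"
      using T by (intro card_mono) auto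
    ultimately show False
      using T by simp
  qed
  with card_solutions_through_tangent_point[OF N this] tangent_point_solution[OF N] show ?thesis
    by blast
qed

text \<open>Reversing the product, of degree \<open>N\<close>, moves the coefficient
  \<gamma>\<open>_j\<close> from index \<open>N - j\<close> to index \<open>j\<close>, the form used
  in \<open>eval_alpha\<close>.\<close>

lemma ulam_poly_roots_solution:
  assumes "monom 1 N + (\<Sum>m=1..N. monom (\<gamma> m) (N - m)) = (\<Prod>n=1..N. [:- \<gamma> n, 1:])"
  shows "restrict \<gamma> {1..N} \<in> ulam_solutions N"
proof -
  let ?p = "\<Prod>n=1..N. [:- \<gamma> n, 1:]"
  have "eval_mpoly (restrict \<gamma> {1..N}) (alpha N j) = 0" if j: "j \<in> {1..N}" for j
  proof -
    have "coeff ?p (N - j) = (\<Sum>m=1..N. if m = j then \<gamma> m else 0)"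
      unfolding assms[symmetric] coeff_add coeff_sum coeff_monom using j
      by (auto intro!: sum.cong simp del: sum.delta sum.delta')
    then have coeff_p: "coeff ?p (N - j) = \<gamma> j"
      using j by simp
    have "degree ?p = N"
      by (subst degree_prod_eq_sum_degree) auto
    moreover have "reflect_poly ?p = (\<Prod>n=1..N. [:1, - \<gamma> n:])"
      unfolding reflect_poly_prod
    by (intro prod.cong refl poly_eqI) (auto simp: coeff_reflect_poly coeff_pCons split: nat.split)
    ultimately have "coeff (\<Prod>n=1..N. [:1, - \<gamma> n:]) j = \<gamma> j"
      using coeff_reflect_poly[of ?p j] j coeff_p by simp
    then have "eval_mpoly \<gamma> (alpha N j) = 0"
      by (simp add: eval_alpha)
    then show ?thesis
      using eval_mpoly_cong[OF polys_in_alpha[OF j], of "restrict \<gamma> {1..N}" \<gamma>] by simp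
  qed
  then show ?thesis
    by (auto simp: ulam_solutions_def)
qed

text \<open>Each Ulam polynomial is determined by the solution formed by its coefficients, so there
  are no more of them than solutions.\<close>

lemma ulam_polys_card:
  assumes "N \<ge> 4"
  shows "finite (ulam_polys N) \<and> card (ulam_polys N) < fact N"
proof -
  define \<Phi> :: "(nat \<Rightarrow> complex) \<Rightarrow> complex poly" where
    "\<Phi> \<gamma> = monom 1 N + (\<Sum>m=1..N. monom (\<gamma> m) (N - m))" for \<gamma>
  have "\<Phi> (restrict \<gamma> {1..N}) = \<Phi> \<gamma>" for \<gamma>
    by (simp add: \<Phi>_def)
  moreover have "restrict \<gamma> {1..N} \<in> ulam_solutions N" if "\<Phi> \<gamma> = (\<Prod>n=1..N. [:- \<gamma> n, 1:])" for \<gamma>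
    using that unfolding \<Phi>_def by (rule ulam_poly_roots_solution)
  ultimately have "ulam_polys N \<subseteq> \<Phi> ` ulam_solutions N"
    unfolding ulam_polys_def \<Phi>_def[symmetric] by (smt (verit) image_iff mem_Collect_eq subsetI)
  moreover have finite: "finite (ulam_solutions N)" and less: "card (ulam_solutions N) < fact N"
    using ulam_solutions_card[OF assms] by auto
  ultimately show ?thesis
    using finite_subset[OF _ finite_imageI[OF finite]] surj_card_le[OF finite] by (blast intro: le_less_trans)
qed

section \<open>The homogenized ideal\<close>

text \<open>The polynomial \<open>C\<^sub>0\<^sup>d p(C\<^sub>1/C\<^sub>0, \<dots>)\<close>. A degree \<open>d\<close> independent of \<open>p\<close> makes this additive in \<open>p\<close>;
  for \<open>d < total_degree p\<close> the truncated subtraction gives a junk value.\<close>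

definition homogenize_to :: "nat \<Rightarrow> mpoly \<Rightarrow> mpoly" where
  "homogenize_to d p = (\<Sum>m\<in>Poly_Mapping.keys p.
     Poly_Mapping.single (m + Poly_Mapping.single 0 (d - mdeg m)) (Poly_Mapping.lookup p m))"

lemma homogenize_to_superset:
  assumes "finite S" "Poly_Mapping.keys p \<subseteq> S"
  shows "homogenize_to d p = (\<Sum>m\<in>S.
     Poly_Mapping.single (m + Poly_Mapping.single 0 (d - mdeg m)) (Poly_Mapping.lookup p m))"
  unfolding homogenize_to_def
  by (rule sum.mono_neutral_left) (use assms in \<open>auto simp: in_keys_iff\<close>)

lemma homogenize_to_0 [simp]: "homogenize_to d 0 = 0"
  by (simp add: homogenize_to_def)

lemma homogenize_to_add: "homogenize_to d (p + q) = homogenize_to d p + homogenize_to d q"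
proof -
  let ?S = "Poly_Mapping.keys p \<union> Poly_Mapping.keys q"
  show ?thesis
    using Poly_Mapping.keys_add[of p q]
    by (simp add: homogenize_to_superset[of ?S] lookup_add single_add sum.distrib)
qed

lemma homogenize_to_uminus: "homogenize_to d (- p) = - homogenize_to d p"
  using homogenize_to_add[of d p "- p"] by (simp add: eq_neg_iff_add_eq_0 add.commute)

lemma homogenize_to_sum: "homogenize_to d (sum f A) = (\<Sum>x\<in>A. homogenize_to d (f x))"
  by (induction A rule: infinite_finite_induct) (auto simp: homogenize_to_add)

lemma homogenize_to_single:
  "homogenize_to d (Poly_Mapping.single m a) =
    Poly_Mapping.single (m + Poly_Mapping.single 0 (d - mdeg m)) a"
  by (simp add: homogenize_to_superset[of "{m}"])

lemma mdeg_add: "mdeg (m + n) = mdeg m + mdeg n"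
proof -
  have "mdeg k = (\<Sum>i\<in>S. Poly_Mapping.lookup k i)" if "finite S" "Poly_Mapping.keys k \<subseteq> S" for k S
    unfolding mdeg_def by (rule sum.mono_neutral_left) (use that in \<open>auto simp: in_keys_iff\<close>)
  from this[of "Poly_Mapping.keys m \<union> Poly_Mapping.keys n"] Poly_Mapping.keys_add[of m n]
  show ?thesis
    by (simp add: lookup_add sum.distrib)
qed

text \<open>The degree bounds keep the truncated subtractions exact, so the exponents of
  \<open>C_0\<close> add.\<close>

lemma homogenize_to_mult:
  assumes "total_degree p \<le> d" "total_degree q \<le> e"
  shows "homogenize_to (d + e) (p * q) = homogenize_to d p * homogenize_to e q"
proof -
  have "p * q = (\<Sum>m\<in>Poly_Mapping.keys p. \<Sum>n\<in>Poly_Mapping.keys q.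
      Poly_Mapping.single (m + n) (Poly_Mapping.lookup p m * Poly_Mapping.lookup q n))"
    by (subst mpoly_eq_sum_single[of p], subst mpoly_eq_sum_single[of q])
       (simp add: sum_product mult_single)
  also have "homogenize_to (d + e) \<dots> = (\<Sum>m\<in>Poly_Mapping.keys p. \<Sum>n\<in>Poly_Mapping.keys q.
      Poly_Mapping.single (m + n + Poly_Mapping.single 0 (d + e - mdeg (m + n)))
        (Poly_Mapping.lookup p m * Poly_Mapping.lookup q n))"
    by (simp only: homogenize_to_sum homogenize_to_single)
  also have "\<dots> = homogenize_to d p * homogenize_to e q"
    unfolding homogenize_to_def sum_product mult_single
  proof (intro sum.cong refl arg_cong2[of _ _ _ _ Poly_Mapping.single])
    fix m n assume "m \<in> Poly_Mapping.keys p" "n \<in> Poly_Mapping.keys q"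
    then have "mdeg m \<le> d" "mdeg n \<le> e"
      using mdeg_le_total_degree assms by (meson order_trans)+
    then have "d + e - mdeg (m + n) = (d - mdeg m) + (e - mdeg n)"
      by (simp add: mdeg_add)
    then show "m + n + Poly_Mapping.single 0 (d + e - mdeg (m + n)) =
        m + Poly_Mapping.single 0 (d - mdeg m) + (n + Poly_Mapping.single 0 (e - mdeg n))"
      by (simp only: single_add add_ac)
  qed
  finally show ?thesis .
qed

lemma total_degree_mult_le: "total_degree (p * q) \<le> total_degree p + total_degree q"
proof -
  have "mdeg k \<le> total_degree p + total_degree q" if "k \<in> Poly_Mapping.keys (p * q)" for k
  proof -
    from that obtain m n where "k = m + n" "m \<in> Poly_Mapping.keys p" "n \<in> Poly_Mapping.keys q"
      using Poly_Mapping.keys_mult[of p q] by blast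
    then show ?thesis
      by (simp add: mdeg_add add_mono mdeg_le_total_degree)
  qed
  then show ?thesis
    by (simp add: total_degree_def[of "p * q"])
qed

lemma total_degree_1 [simp]: "total_degree 1 = 0"
  by (simp add: total_degree_def mdeg_def)

lemma homogenize_to_power:
  assumes "total_degree p \<le> d"
  shows "homogenize_to (n * d) (p ^ n) = homogenize_to d p ^ n"
proof (induction n)
  case 0
  show ?case
    using homogenize_to_single[of 0 0 1] by (simp add: mdeg_def)
next
  case (Suc n)
  have "total_degree (p ^ n) \<le> n * d" for n
  proof (induction n)
    case (Suc n)
    with assms total_degree_mult_le[of p "p ^ n"] show ?case
      by simp
  qed simp
  with assms Suc show ?case
    by (simp add: homogenize_to_mult)
qed

lemma homogenize_to_polys_in:
  assumes "p \<in> polys_in {1..N}"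
  shows "homogenize_to d p \<in> polys_in {0..N}"
  unfolding homogenize_to_def
proof (intro polys_in_sum polys_in_single)
  fix m assume "m \<in> Poly_Mapping.keys p"
  with assms have "Poly_Mapping.keys m \<subseteq> {0..N}"
    by (fastforce simp: polys_in_def)
  then show "Poly_Mapping.keys (m + Poly_Mapping.single 0 (d - mdeg m)) \<subseteq> {0..N}"
    using Poly_Mapping.keys_add[of m "Poly_Mapping.single 0 (d - mdeg m)"]
    by (auto split: if_splits)
qed

lemma eval_homogenize_to:
  "C 0 = 1 \<Longrightarrow> eval_mpoly C (homogenize_to d p) = eval_mpoly C p"
  unfolding homogenize_to_def eval_mpoly_sum eval_mpoly_single eval_monom_add eval_monom_single
  by (simp add: eval_mpoly_def)

lemma homogenize_eq: "homogenize p = homogenize_to (total_degree p) p"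
  by (simp add: homogenize_def homogenize_to_def)

text \<open>The curve has \<open>C_0 = 1\<close>, so homogenization does not change values along
  it.\<close>

lemma flat_homogenize_to: "flat (homogenize_to d p) \<longleftrightarrow> flat p"
  by (simp add: flat_def eval_homogenize_to tangent_curve_def)

lemma ulam_hom_ideal_ideal: "ideal (ulam_hom_ideal N) (ring_on (polys_in {0..N}))"
  and homogenize_alpha_in: "j \<in> {1..N} \<Longrightarrow> homogenize (alpha N j) \<in> ulam_hom_ideal N"
  and flat_ulam_hom_ideal: "N \<ge> 4 \<Longrightarrow> f \<in> ulam_hom_ideal N \<Longrightarrow> flat f"
proof -
  interpret cring "mpoly_ring {0..N}" by (rule cring_mpoly_ring)
  have carr: "(\<lambda>j. homogenize (alpha N j)) ` {1..N} \<subseteq> carrier (mpoly_ring {0..N})"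
    using homogenize_to_polys_in[OF polys_in_alpha] by (auto simp: mpoly_ring_def homogenize_eq)
  show "ideal (ulam_hom_ideal N) (ring_on (polys_in {0..N}))"
    using genideal_ideal[OF carr] by (simp add: ulam_hom_ideal_def mpoly_ring_def)
  show "homogenize (alpha N j) \<in> ulam_hom_ideal N" if "j \<in> {1..N}"
    using genideal_self[OF carr] that by (auto simp: ulam_hom_ideal_def)
  show "flat f" if "N \<ge> 4" "f \<in> ulam_hom_ideal N"
  proof -
    have "ulam_hom_ideal N \<subseteq> {f \<in> polys_in {0..N}. flat f}"
      unfolding ulam_hom_ideal_def
    proof (rule genideal_minimal)
      show "ideal {f \<in> polys_in {0..N}. flat f} (mpoly_ring {0..N})"
        unfolding mpoly_ring_def by (rule ideal_flat)
      show "(\<lambda>j. homogenize (alpha N j)) ` {1..N} \<subseteq> {f \<in> polys_in {0..N}. flat f}"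
        using carr flat_alpha[OF that(1)] by (auto simp: mpoly_ring_def homogenize_eq flat_homogenize_to)
    qed
    with that show ?thesis
      by blast
  qed
qed

lemmas ulam_hom_ideal_rules = ideal_ring_onD[OF ulam_hom_ideal_ideal]

text \<open>Terms in a combination of the generators may have higher degree than \<open>f\<close>
  itself; once \<open>d\<close> is at least their degrees, each term can be homogenized
  separately.\<close>

lemma homogenize_to_ulam_ideal:
  assumes "f \<in> ulam_ideal N"
  obtains d0 where "\<And>d. d \<ge> d0 \<Longrightarrow> homogenize_to d f \<in> ulam_hom_ideal N"
proof -
  define K where "K = {f \<in> polys_in {1..N}. \<exists>d0. \<forall>d\<ge>d0. homogenize_to d f \<in> ulam_hom_ideal N}"
  have multiple: "homogenize_to d (g * f) \<in> ulam_hom_ideal N"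
    if "g \<in> polys_in {1..N}" "homogenize_to e f \<in> ulam_hom_ideal N" "total_degree f \<le> e"
      "total_degree g + e \<le> d" for d e f g
  proof -
    have "homogenize_to (d - e + e) (g * f) = homogenize_to (d - e) g * homogenize_to e f"
      by (rule homogenize_to_mult) (use that in auto)
    moreover have "homogenize_to (d - e) g * homogenize_to e f \<in> ulam_hom_ideal N"
      by (intro ulam_hom_ideal_rules(4) homogenize_to_polys_in that)
    ultimately show ?thesis
      using that by simp
  qed
  have "ideal K (ring_on (polys_in {1..N}))"
  proof (rule ideal_ring_onI)
    show "cring (ring_on (polys_in {1..N}))"
      using cring_mpoly_ring[of "{1..N}"] by (simp add: mpoly_ring_def)
  next
    fix x y assume "x \<in> K" "y \<in> K"
    then obtain d e where "\<forall>k\<ge>d. homogenize_to k x \<in> ulam_hom_ideal N"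
      "\<forall>k\<ge>e. homogenize_to k y \<in> ulam_hom_ideal N"
      by (auto simp: K_def)
    then have "\<forall>k\<ge>max d e. homogenize_to k (x + y) \<in> ulam_hom_ideal N"
      by (auto simp: homogenize_to_add intro: ulam_hom_ideal_rules(3))
    with \<open>x \<in> K\<close> \<open>y \<in> K\<close> show "x + y \<in> K"
      unfolding K_def by (blast intro: polys_in_add)
  next
    have neg: "- x \<in> ulam_hom_ideal N" if "x \<in> ulam_hom_ideal N" for x
      using ulam_hom_ideal_rules(4)[OF polys_in_uminus[OF polys_in_1] that] by simp
    show "- x \<in> K" if "x \<in> K" for x
      using that neg by (auto simp: K_def polys_in_uminus homogenize_to_uminus)
  next
    fix x y assume x: "x \<in> polys_in {1..N}" and "y \<in> K"
    then obtain e where e: "\<forall>k\<ge>e. homogenize_to k y \<in> ulam_hom_ideal N" and y: "y \<in> polys_in {1..N}"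
      by (auto simp: K_def)
    have "homogenize_to d (x * y) \<in> ulam_hom_ideal N"
      if "d \<ge> total_degree x + (total_degree y + e)" for d
      by (rule multiple[OF x]) (use e that in auto)
    with x y show "x * y \<in> K"
      by (auto simp: K_def polys_in_mult)
  qed (auto simp: K_def polys_in_0 ulam_hom_ideal_rules(2))
  moreover have "alpha N j \<in> K" if j: "j \<in> {1..N}" for j
  proof -
    have "homogenize_to d (1 * alpha N j) \<in> ulam_hom_ideal N" if "d \<ge> total_degree (alpha N j)" for d
      by (rule multiple[OF polys_in_1])
         (use that homogenize_alpha_in[OF j] in \<open>auto simp: homogenize_eq\<close>)
    with polys_in_alpha[OF j] show ?thesis
      by (auto simp: K_def)
  qed
  ultimately have "ulam_ideal N \<subseteq> K"
    by (rule ulam_ideal_subsetI)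
  with assms show thesis
    using that by (auto simp: K_def)
qed

text \<open>The \<open>N! + 1\<close> powers of \<open>c_4\<close> are dependent modulo the ideal.
  Splitting the lowest power off the dependence leaves a factor \<open>q\<close> that is nonzero at
  the tangent point.\<close>

lemma non_flat_power_in_ulam_ideal:
  assumes N: "N \<ge> 4"
  obtains f n where "f \<in> polys_in {1..N}" "\<not> flat f" "f ^ n \<in> ulam_ideal N"
proof -
  have Var4: "Var 4 \<in> polys_in {1..N}"
    using N by (intro Var_in_polys_in) auto
  let ?J = "{..fact N :: nat}"
  obtain b where b: "\<exists>j\<in>?J. b j \<noteq> 0" "(\<Sum>j\<in>?J. Const (b j) * Var 4 ^ j) \<in> ulam_ideal N"
    by (rule ulam_ideal_dependence[of ?J N "\<lambda>j. Var 4 ^ j"])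
      (simp_all add: polys_in_power[OF Var4] del: One_nat_def)
  define n where "n = (LEAST j. b j \<noteq> 0)"
  have n: "b n \<noteq> 0" "\<And>j. j < n \<Longrightarrow> b j = 0"
    using b(1) LeastI[of "\<lambda>j. b j \<noteq> 0"] not_less_Least[of _ "\<lambda>j. b j \<noteq> 0"]
    unfolding n_def by blast+
  have "n \<le> fact N"
    using b(1) n(2) by (metis atMost_iff leI le_trans)
  define q where "q = (\<Sum>j\<in>{n..fact N}. Const (b j) * Var 4 ^ (j - n))"
  have q: "q \<in> polys_in {1..N}"
    unfolding q_def by (intro polys_in_sum polys_in_mult Const_in_polys_in polys_in_power Var4)
  have "Var 4 ^ n * q = (\<Sum>j\<in>{n..fact N}. Const (b j) * Var 4 ^ j)"
    unfolding q_def sum_distrib_left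
    by (intro sum.cong) (auto simp: mult.left_commute simp flip: power_add)
  also have "\<dots> = (\<Sum>j\<in>?J. Const (b j) * Var 4 ^ j)"
    by (intro sum.mono_neutral_left) (auto simp: n(2))
  finally have "Var 4 ^ n * q \<in> ulam_ideal N"
    using b(2) by simp
  \<comment> \<open>The multiplier is chosen to complete the product to a power of
    \<open>Var 4 * q\<close>.\<close>
  then have "(Var 4 * q ^ n) * (Var 4 ^ n * q) \<in> ulam_ideal N"
    by (rule ulam_ideal_rules(4)[rotated]) (intro polys_in_mult polys_in_power Var4 q)
  then have power: "(Var 4 * q) ^ Suc n \<in> ulam_ideal N"
    by (simp add: power_mult_distrib mult_ac)
  have "eval_mpoly (tangent_curve 0) q = (\<Sum>j\<in>{n..fact N}. b j * 0 ^ (j - n))"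
    by (simp add: q_def eval_mpoly_sum eval_mpoly_mult eval_power eval_Const eval_Var tangent_curve_def)
  \<comment> \<open>Since \<open>0 ^ 0 = 1\<close>, exactly the summand \<open>j = n\<close>
    survives.\<close>
  also have "\<dots> = (\<Sum>j\<in>{n..fact N}. if j = n then b n else 0)"
    by (intro sum.cong) auto
  finally have "eval_mpoly (tangent_curve 0) q = \<dots>" .
  then have q0: "eval_mpoly (tangent_curve 0) q \<noteq> 0"
    using n(1) \<open>n \<le> fact N\<close> by simp
  \<comment> \<open>Its derivative along the curve is the value of \<open>q\<close> at the point, which is not 0.\<close>
  have "\<not> flat (Var 4 * q)"
  proof
    assume "flat (Var 4 * q)"
    then have "flat (Var 4)"
      using q0 by (rule flat_multD)
    then show False
      using flat_tangent(2)[of "Var 4" 0 1] by (simp add: eval_Var tangent_curve_def)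
  qed
  then show thesis
    by (rule that[OF polys_in_mult[OF Var4 q] _ power])
qed

text \<open>Homogenizing the previous \<open>f\<close> in a large degree puts its power into the
  ideal, while \<open>f\<close> itself stays outside because it is not flat.\<close>

lemma ulam_hom_ideal_not_radical:
  assumes N: "N \<ge> 4"
  shows "\<not> is_radical (mpoly_ring {0..N}) (ulam_hom_ideal N)"
proof
  assume rad: "is_radical (mpoly_ring {0..N}) (ulam_hom_ideal N)"
  obtain f n where f: "f \<in> polys_in {1..N}" "\<not> flat f" "f ^ n \<in> ulam_ideal N"
    by (rule non_flat_power_in_ulam_ideal[OF N])
  have "n \<noteq> 0"
  proof
    assume "n = 0"
    then have "flat 1"
      using f(3) flat_ulam_ideal[OF N, of 1] by simp
    then show False
      by (simp add: flat_def)
  qed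
  obtain d0 where d0: "\<And>d. d \<ge> d0 \<Longrightarrow> homogenize_to d (f ^ n) \<in> ulam_hom_ideal N"
    by (rule homogenize_to_ulam_ideal[OF f(3)]) blast
  \<comment> \<open>Large enough for \<open>homogenize_to_power\<close> and, as \<open>n\<close> is
    positive, for \<open>n * d\<close> to reach \<open>d0\<close>.\<close>
  define d where "d = total_degree f + d0"
  have "d0 \<le> n * d"
    using \<open>n \<noteq> 0\<close> by (cases n) (auto simp: d_def)
  then have "homogenize_to d f ^ n \<in> ulam_hom_ideal N"
    using d0[of "n * d"] homogenize_to_power[of f d n] by (simp add: d_def)
  moreover have "g [^]\<^bsub>mpoly_ring {0..N}\<^esub> n = g ^ n" for g and n :: nat
    by (induction n) (auto simp: mpoly_ring_def nat_pow_def mult.commute)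
  ultimately have "homogenize_to d f \<in> ulam_hom_ideal N"
    using rad homogenize_to_polys_in[OF f(1), of d] by (auto simp: is_radical_def mpoly_ring_def)
  then have "flat (homogenize_to d f)"
    by (rule flat_ulam_hom_ideal[OF N])
  with f(2) show False
    by (simp add: flat_homogenize_to)
qed

theorem theorem3p7:
  fixes N :: nat
  assumes "N \<ge> 4"
  shows "(\<exists>P \<in> ulam_solutions N. local_multiplicity N (ulam_ideal N) P > 1)
    \<and> (finite (ulam_polys N) \<and> card (ulam_polys N) < fact N)
    \<and> \<not> is_radical (mpoly_ring {0..N}) (ulam_hom_ideal N)"
  using local_multiplicity_tangent_point[OF assms] tangent_point_solution[OF assms]
    ulam_polys_card[OF assms] ulam_hom_ideal_not_radical[OF assms]
  by blast

end
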